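(* Let $q$ be a prime power, $n\ge1$, $\sigma$ a generator of $\mathrm{Gal}(\mathbb{F}_{q^n}/\mathbb{F}_q)$, and $L=ax+bx^{\sigma}+cx^{\sigma^2}+dx^{\sigma^3}$ with $a,b,c,d\in\mathbb{F}_{q^n}$, $ad\neq0$. Let $P_L(y)=a+by+cy^{\sigma+1}+dy^{\sigma^2+\sigma+1}$. For an eigenvalue of $A_L$ write $(m_a,m_g)$ for its (algebraic, geometric) multiplicity pair. Then, counting roots in $\mathbb{F}_{q^n}$: - $P_L$ has $q^2+q+1$ roots iff $A_L$ has exactly one eigenvalue in $\mathbb{F}_q$, with $(m_a,m_g)=(3,3)$; - $P_L$ has $q+1$ roots iff $A_L$ has exactly one eigenvalue in $\mathbb{F}_q$, with $(m_a,m_g)=(3,2)$; - $P_L$ has $1$ root iff $A_L$ has exactly one eigenvalue in $\mathbb{F}_q$, with $(m_a,m_g)=(3,1)$ or $(1,1)$; - $P_L$ has $q+2$ roots iff $A_L$ has one eigenvalue in $\mathbb{F}_q$ with $(m_a,m_g)=(1,1)$ and one eigenvalue in $\mathbb{F}_q$ with $(m_a,m_g)=(2,2)$; - $P_L$ has $2$ roots iff $A_L$ has one eigenvalue in $\mathbb{F}_q$ with $(m_a,m_g)=(1,1)$ and one eigenvalue in $\mathbb{F}_q$ with $(m_a,m_g)=(2,1)$; - $P_L$ has $3$ roots iff $A_L$ has three distinct eigenvalues in $\mathbb{F}_q$, each with $(m_a,m_g)=(1,1)$; - $P_L$ has $0$ roots iff $A_L$ has no eigenvalues in $\mathbb{F}_q$.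 There are no other possibilities.
   Context: Here $y^{\sigma+1}=y^\sigma\cdot y$ etc. $C_L=\begin{pmatrix}0&0&-a/d\\1&0&-b/d\\0&1&-c/d\end{pmatrix}$ and $A_L=C_LC_L^{\sigma}\cdots C_L^{\sigma^{n-1}}$, where $C_L^{\sigma^i}$ denotes entrywise application of $\sigma^i$. Eigenvalues of $A_L$ are taken in an algebraic closure of $\mathbb{F}_{q^n}$.
   Formalization: In the sixth bullet, the direction "3 roots implies three distinct eigenvalues in F_q" is claimed only for q ≠ 2: when q = 2, 3 = q+1 roots can occur (e.g. over F_8), but the invertible A_L cannot have three distinct eigenvalues in F_2. *)

theory Defs
  imports
    "HOL-Algebra.Algebraic_Closure_Type"
    "HOL-Algebra.Generated_Groups"
    "HOL-Algebra.QuotRing"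
    "HOL-Number_Theory.Prime_Powers"
    "Jordan_Normal_Form.Char_Poly"
    "Jordan_Normal_Form.Matrix_Kernel"
begin

text \<open>
  The field $\mathbb{F}_{q^n}$ is a type of class \<open>{field, finite}\<close>, its subfield
  $\mathbb{F}_q$ is a set \<open>F\<close> of elements of that type. \<open>ring_of_type_algebra\<close>
  is the whole type viewed as a HOL-Algebra ring.
\<close>

definition is_subfield :: "'a::field set \<Rightarrow> bool" where
  "is_subfield F \<longleftrightarrow> subfield F (ring_of_type_algebra :: 'a ring)"

definition galois_group :: "'a::field set \<Rightarrow> ('a \<Rightarrow> 'a) monoid" where
  "galois_group F =
     \<lparr> carrier = {\<tau> \<in> ring_iso ring_of_type_algebra ring_of_type_algebra. \<forall>x\<in>F. \<tau> x = x},
       monoid.mult = (\<circ>), one = id \<rparr>"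

definition generates_galois_group :: "('a::field \<Rightarrow> 'a) \<Rightarrow> 'a set \<Rightarrow> bool" where
  "generates_galois_group \<sigma> F \<longleftrightarrow>
     \<sigma> \<in> carrier (galois_group F) \<and>
     generate (galois_group F) {\<sigma>} = carrier (galois_group F)"

text \<open>
  The \<open>\<sigma>\<close>-polynomial $L = ax + bx^{\sigma} + cx^{\sigma^2} + dx^{\sigma^3}$ is
  represented by its coefficients.
\<close>

definition P_L :: "('a::field \<Rightarrow> 'a) \<Rightarrow> 'a \<Rightarrow> 'a \<Rightarrow> 'a \<Rightarrow> 'a \<Rightarrow> 'a \<Rightarrow> 'a" where
  "P_L \<sigma> a b c d y = a + b * y + c * (\<sigma> y * y) + d * (\<sigma> (\<sigma> y) * \<sigma> y * y)"

definition C_L :: "'a::field \<Rightarrow> 'a \<Rightarrow> 'a \<Rightarrow> 'a \<Rightarrow> 'a mat" where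
  "C_L a b c d = mat_of_rows_list 3
     [[0, 0, - a / d],
      [1, 0, - b / d],
      [0, 1, - c / d]]"

primrec twisted_power :: "('a::field \<Rightarrow> 'a) \<Rightarrow> 'a mat \<Rightarrow> nat \<Rightarrow> 'a mat" where
  "twisted_power \<sigma> C 0 = 1\<^sub>m (dim_row C)"
| "twisted_power \<sigma> C (Suc k) = twisted_power \<sigma> C k * map_mat (\<sigma> ^^ k) C"

definition A_L :: "('a::field \<Rightarrow> 'a) \<Rightarrow> nat \<Rightarrow> 'a \<Rightarrow> 'a \<Rightarrow> 'a \<Rightarrow> 'a \<Rightarrow> 'a mat" where
  "A_L \<sigma> n a b c d = twisted_power \<sigma> (C_L a b c d) n"

definition eigenvalues_in :: "'a::field set \<Rightarrow> 'a mat \<Rightarrow> 'a alg_closure set" where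
  "eigenvalues_in F A = {e \<in> to_ac ` F. eigenvalue (map_mat to_ac A) e}"

text \<open>
  The qualified name avoids the group order \<open>Coset.order\<close>. The matrix
  \<open>char_matrix B e\<close> is \<open>B - e I\<close>, so its kernel is the eigenspace of \<open>e\<close>.
\<close>

definition alg_mult :: "'a::field mat \<Rightarrow> 'a alg_closure \<Rightarrow> nat" where
  "alg_mult A e = Polynomial.order e (char_poly (map_mat to_ac A))"

definition geom_mult :: "'a::field mat \<Rightarrow> 'a alg_closure \<Rightarrow> nat" where
  "geom_mult A e = kernel_dim (char_matrix (map_mat to_ac A) e)"

text \<open>
  One pair (algebraic, geometric multiplicity) for each eigenvalue lying in \<open>F\<close>.
  For finite \<open>F\<close>, \<open>multiplicity_pairs F A = {#p, r#}\<close> says that there are exactly two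
  distinct eigenvalues in \<open>F\<close>, one with multiplicity pair \<open>p\<close> and the other with \<open>r\<close>.
\<close>

definition multiplicity_pairs :: "'a::field set \<Rightarrow> 'a mat \<Rightarrow> (nat \<times> nat) multiset" where
  "multiplicity_pairs F A =
     image_mset (\<lambda>e. (alg_mult A e, geom_mult A e)) (mset_set (eigenvalues_in F A))"

end

(*
  Let w = (1, y, y \<sigma>(y)) and C = C_L. Then P_L(y) = 0 holds iff w C = y \<sigma>(w), and iterating
  this n times gives w A_L = N(y) w, where N is the norm to F. So every root y yields a left
  eigenvector of A_L for the eigenvalue N(y) in F. Conversely, fix e in F and y with N(y) = e. On the
  left e-eigenspace E of A_L, the \<sigma>-semilinear map S(w) = y \<sigma>(w) C^-1 satisfies S^n = 1, so by
  Galois descent it has q^g fixed vectors, where g = dim E. Double counting the pairs (y, w) with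
  N(y) = e, w nonzero and S(w) = w shows that e is the norm of exactly (q^g - 1) / (q - 1) roots.
  Finally, A_L is similar to its \<sigma>-conjugate, so its characteristic polynomial has coefficients
  in F. Its roots in F, counted with multiplicity, therefore number 0, 1 or 3, never 2, which
  leaves only the listed cases.
*)
theory Submission
  imports Defs "HOL-Library.Function_Algebras" "HOL-Number_Theory.Residues"
begin

subsection \<open>Galois descent for semilinear maps over a finite field\<close>

text \<open>The argument works with cardinalities throughout. Starting from one fixed y of norm e,
  reaching every root of norm e would take Hilbert 90; letting y range over the whole norm fibre
  makes only the size of that fibre matter, and it cancels. That size is itself obtained from
  descent in dimension one. Descent needs the exact order of \<sigma>, while the hypotheses speak of
  the degree n. The two agree because descent also gives that the large field has as many elements
  as the fixed field raised to the order of \<sigma>. The count 3 needs care: for q = 2 it coincides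
  with q + 1. Since \<open>A_L\<close> is invertible, its eigenvalues in F are nonzero, so three
  distinct ones require q > 3. Hence for q = 2 a count of 3 belongs to the pair (3,2), and it points
  to three simple eigenvalues only for other q.\<close>

lemma dedekind_independence:
  fixes \<chi> :: "'i \<Rightarrow> 'a::monoid_mult \<Rightarrow> 'b::field"
  assumes "finite I" "inj_on \<chi> I"
    and "\<And>i. i \<in> I \<Longrightarrow> \<chi> i 1 = 1"
    and "\<And>i x y. i \<in> I \<Longrightarrow> \<chi> i (x * y) = \<chi> i x * \<chi> i y"
    and "\<And>x. (\<Sum>i\<in>I. c i * \<chi> i x) = 0"
    and "j \<in> I"
  shows "c j = 0"
  using assms
proof (induction I arbitrary: c j rule: finite_induct)
  case (insert k I)
  have sum0: "c k * \<chi> k x + (\<Sum>i\<in>I. c i * \<chi> i x) = 0" for x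
    using insert.prems(4)[of x] insert.hyps by simp
  have c0: "c i = 0" if i: "i \<in> I" for i
  proof -
    have "\<chi> i \<noteq> \<chi> k"
      using insert.prems(1) insert.hyps i by (auto simp: inj_on_def)
    then obtain z where z: "\<chi> i z \<noteq> \<chi> k z" by blast
    \<comment> \<open>The relation at \<open>z * x\<close> minus \<open>\<chi> k z\<close> times the
      relation at \<open>x\<close>: the term of \<open>k\<close> cancels, and a shorter relation
      remains for the induction hypothesis.\<close>
    have "(\<Sum>i\<in>I. (c i * (\<chi> i z - \<chi> k z)) * \<chi> i x) = 0" for x
    proof -
      have "(\<Sum>i\<in>I. (c i * (\<chi> i z - \<chi> k z)) * \<chi> i x)
          = (\<Sum>i\<in>I. c i * \<chi> i (z * x)) - \<chi> k z * (\<Sum>i\<in>I. c i * \<chi> i x)"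
        unfolding sum_distrib_left sum_subtractf[symmetric]
        by (rule sum.cong) (auto simp: insert.prems(3) algebra_simps)
      also have "(\<Sum>i\<in>I. c i * \<chi> i (z * x)) = - (c k * \<chi> k (z * x))"
        using sum0[of "z * x"] by (simp add: eq_neg_iff_add_eq_0 add.commute)
      also have "(\<Sum>i\<in>I. c i * \<chi> i x) = - (c k * \<chi> k x)"
        using sum0[of x] by (simp add: eq_neg_iff_add_eq_0 add.commute)
      finally show ?thesis by (simp add: insert.prems(3))
    qed
    from insert.IH[OF _ _ _ this i] insert.prems have "c i * (\<chi> i z - \<chi> k z) = 0"
      by (auto simp: inj_on_def)
    then show ?thesis using z by simp
  qed
  then have "c k = 0" using sum0[of 1] insert.prems(2) by simp
  then show ?case using c0 insert.prems(5) by auto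
qed simp

text \<open>\<open>funpow_n\<close> and \<open>funpow_inj\<close> together make \<open>n\<close> the
  exact order of \<sigma>; distinctness of the powers is what independence of characters
  requires.\<close>

locale cyclic_automorphism =
  fixes \<sigma> :: "'a::{field,finite} \<Rightarrow> 'a" and n :: nat
  assumes hom_add: "\<sigma> (x + y) = \<sigma> x + \<sigma> y"
    and hom_mult: "\<sigma> (x * y) = \<sigma> x * \<sigma> y"
    and hom_one: "\<sigma> 1 = 1"
    and n_pos: "n > 0"
    and funpow_n: "\<sigma> ^^ n = id"
    and funpow_inj: "inj_on (\<lambda>i. \<sigma> ^^ i) {..<n}"
begin

definition fixed :: "'a set" where "fixed = {x. \<sigma> x = x}"

lemma hom_zero: "\<sigma> 0 = 0"
proof -
  have "\<sigma> 0 + 0 = \<sigma> 0 + \<sigma> 0" using hom_add[of 0 0] by simp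
  then show ?thesis by (simp only: add_left_cancel)
qed

lemma hom_sum: "\<sigma> (sum f A) = (\<Sum>x\<in>A. \<sigma> (f x))"
  by (induction A rule: infinite_finite_induct) (auto simp: hom_zero hom_add)

lemma hom_prod: "\<sigma> (prod f A) = (\<Prod>x\<in>A. \<sigma> (f x))"
  by (induction A rule: infinite_finite_induct) (auto simp: hom_one hom_mult)

lemma hom_uminus: "\<sigma> (- x) = - \<sigma> x"
  using hom_add[of x "- x"] by (simp add: hom_zero eq_neg_iff_add_eq_0 add.commute)

lemma hom_eq_0_iff: "\<sigma> x = 0 \<longleftrightarrow> x = 0"
proof
  assume "\<sigma> x = 0"
  then show "x = 0"
    using hom_mult[of x "inverse x"] hom_one by (cases "x = 0") auto
qed (simp add: hom_zero)

lemma hom_inverse: "\<sigma> (inverse x) = inverse (\<sigma> x)"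
proof (cases "x = 0")
  case False
  then have "\<sigma> x * \<sigma> (inverse x) = 1" by (simp flip: hom_mult add: hom_one)
  then show ?thesis by (simp add: inverse_unique)
qed (simp add: hom_zero)

lemma hom_divide: "\<sigma> (x / y) = \<sigma> x / \<sigma> y"
  by (simp add: divide_inverse hom_mult hom_inverse)

lemma funpow_mult: "(\<sigma> ^^ i) (x * y) = (\<sigma> ^^ i) x * (\<sigma> ^^ i) y"
  by (induction i) (auto simp: hom_mult)

lemma funpow_one: "(\<sigma> ^^ i) 1 = 1"
  by (induction i) (auto simp: hom_one)

lemma funpow_eq_0_iff: "(\<sigma> ^^ i) x = 0 \<longleftrightarrow> x = 0"
  by (induction i) (auto simp: hom_eq_0_iff)

lemma card_UNIV_gt_1: "card (UNIV :: 'a set) > 1"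
proof -
  have "{0, 1} \<subseteq> (UNIV :: 'a set)" by simp
  from card_mono[OF _ this] show ?thesis by simp
qed

lemma vector_space_self: "vector_space ((*) :: 'a \<Rightarrow> 'a \<Rightarrow> 'a)"
  by unfold_locales (auto simp: algebra_simps)

text \<open>A maximal set B of fixed vectors independent over the large field spans E, and in
  coordinates over B the map S is just \<sigma>. Both cardinalities carry the same exponent, so a
  later use can read k off the size of E and transfer it to the fixed vectors.\<close>

lemma descent:
  fixes scale :: "'a \<Rightarrow> 'b::ab_group_add \<Rightarrow> 'b" and S :: "'b \<Rightarrow> 'b"
  assumes vs: "vector_space scale"
    and sub: "module.subspace scale E"
    and fin: "finite E"
    and SE: "\<And>x. x \<in> E \<Longrightarrow> S x \<in> E"
    and S_add: "\<And>x y. x \<in> E \<Longrightarrow> y \<in> E \<Longrightarrow> S (x + y) = S x + S y"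
    and S_scale: "\<And>c x. x \<in> E \<Longrightarrow> S (scale c x) = scale (\<sigma> c) (S x)"
    and S_n: "\<And>x. x \<in> E \<Longrightarrow> (S ^^ n) x = x"
  obtains k where "card E = card (UNIV :: 'a set) ^ k" "card {x \<in> E. S x = x} = card fixed ^ k"
proof -
  interpret V: vector_space scale by (rule vs)
  interpret K: vector_space "(*) :: 'a \<Rightarrow> 'a \<Rightarrow> 'a" by (rule vector_space_self)
  interpret P: vector_space_pair scale "(*) :: 'a \<Rightarrow> 'a \<Rightarrow> 'a" ..
  define W where "W = {x \<in> E. S x = x}"
  obtain B where B: "B \<subseteq> W" "V.independent B" "W \<subseteq> V.span B"
    by (rule V.maximal_independent_subset)
  have finB: "finite B" using B(1) fin by (auto simp: W_def intro: finite_subset)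
  have S_sum: "S (sum f A) = (\<Sum>x\<in>A. S (f x))"
    if "finite A" "\<And>x. x \<in> A \<Longrightarrow> f x \<in> E" for f :: "'i \<Rightarrow> 'b" and A
    using that
  proof (induction A)
    case empty
    have "0 \<in> E" by (rule V.subspace_0[OF sub])
    then have "S 0 = scale (\<sigma> 0) (S 0)" using S_scale[of 0 0] by simp
    then show ?case by (simp add: hom_zero)
  next
    case (insert x A)
    then show ?case by (simp add: S_add V.subspace_sum[OF sub])
  qed
  have SiE: "(S ^^ i) x \<in> E" if "x \<in> E" for i x
    using that by (induction i) (auto intro: SE)
  have "E \<subseteq> V.span B"
  proof (rule ccontr)
    assume "\<not> E \<subseteq> V.span B"
    then obtain w where w: "w \<in> E" "w \<notin> V.span B" by blast
    then have ind: "V.independent (insert w B)"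
      using B(2) by (simp add: V.independent_insert)
    \<comment> \<open>A functional that vanishes on the span of B, hence on all fixed vectors, but
      not on w. Applied to traces, it will produce a forbidden relation between the powers of
      \<sigma>.\<close>
    from P.linear_independent_extend[OF ind, of "\<lambda>x. if x = w then 1 else 0"]
    obtain f where f: "Vector_Spaces.linear scale (*) f"
      "\<forall>x\<in>insert w B. f x = (if x = w then 1 else 0)" by blast
    interpret f: Vector_Spaces.linear scale "(*)" f by (rule f(1))
    have "w \<notin> B" using w(2) V.span_base by blast
    then have fB: "f x = 0" if "x \<in> B" for x using f(2) that by auto
    have fspan: "f x = 0" if "x \<in> V.span B" for x
      using P.linear_eq_0_on_span[OF f(1) fB that] by simp
    \<comment> \<open>The trace of \<open>scale \<alpha> w\<close> over the powers of S. S shifts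
      its terms, and the shift closes up because the n-th iterates of \<sigma> and S are trivial; so
      every trace is a fixed vector.\<close>
    define T where "T \<alpha> = (\<Sum>i<n. scale ((\<sigma> ^^ i) \<alpha>) ((S ^^ i) w))" for \<alpha>
    have "T \<alpha> \<in> W" for \<alpha>
    proof -
      have TE: "T \<alpha> \<in> E" unfolding T_def
        by (intro V.subspace_sum[OF sub] V.subspace_scale[OF sub] SiE w)
      have "S (T \<alpha>) = (\<Sum>i<n. scale ((\<sigma> ^^ Suc i) \<alpha>) ((S ^^ Suc i) w))"
        unfolding T_def by (subst S_sum)
          (auto intro!: V.subspace_scale[OF sub] SiE w sum.cong simp: S_scale SiE w)
      also have "\<dots> = T \<alpha> + scale ((\<sigma> ^^ n) \<alpha>) ((S ^^ n) w) - scale \<alpha> w"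
      proof -
        have "(\<Sum>i<Suc n. scale ((\<sigma> ^^ i) \<alpha>) ((S ^^ i) w))
            = scale \<alpha> w + (\<Sum>i<n. scale ((\<sigma> ^^ Suc i) \<alpha>) ((S ^^ Suc i) w))"
          by (subst sum.lessThan_Suc_shift) simp
        then show ?thesis by (simp add: T_def algebra_simps)
      qed
      also have "\<dots> = T \<alpha>" by (simp add: funpow_n S_n w)
      finally show ?thesis using TE by (simp add: W_def)
    qed
    then have "f (T \<alpha>) = 0" for \<alpha> using B(3) fspan by blast
    then have "(\<Sum>i<n. f ((S ^^ i) w) * (\<sigma> ^^ i) \<alpha>) = 0" for \<alpha>
      unfolding T_def by (simp add: f.sum f.scale mult.commute)
    \<comment> \<open>The coefficient of \<open>\<sigma> ^^ 0\<close> is \<open>f w\<close>, which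
      was chosen to be 1.\<close>
    from dedekind_independence[OF _ funpow_inj _ _ this, of 0]
    have "f w = 0" using n_pos by (simp add: funpow_one funpow_mult)
    then show False using f(2) by simp
  qed
  moreover have BE: "B \<subseteq> E" using B(1) by (auto simp: W_def)
  ultimately have spanB: "V.span B = E" using V.span_minimal[OF _ sub, of B] by blast
  define L where "L c = (\<Sum>b\<in>B. scale (c b) b)" for c
  have inj: "inj_on L (B \<rightarrow>\<^sub>E UNIV)"
  proof (rule inj_onI)
    fix c d assume cd: "c \<in> B \<rightarrow>\<^sub>E UNIV" "d \<in> B \<rightarrow>\<^sub>E UNIV" "L c = L d"
    have "(\<Sum>b\<in>B. scale (c b - d b) b) = 0"
      using cd(3) by (simp add: L_def V.scale_left_diff_distrib sum_subtractf)
    then have "c b - d b = 0" if "b \<in> B" for b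
      using V.independentD[OF B(2) finB subset_refl _ that, of "\<lambda>b. c b - d b"] by blast
    then show "c = d" using cd by (intro PiE_ext) auto
  qed
  have imE: "L ` (B \<rightarrow>\<^sub>E UNIV) = E"
  proof
    show "L ` (B \<rightarrow>\<^sub>E UNIV) \<subseteq> E"
      using BE by (auto simp: L_def intro!: V.subspace_sum[OF sub] V.subspace_scale[OF sub])
    show "E \<subseteq> L ` (B \<rightarrow>\<^sub>E UNIV)"
    proof
      fix x assume "x \<in> E"
      then obtain u where "x = (\<Sum>b\<in>B. scale (u b) b)"
        using spanB V.span_finite[OF finB] by auto
      then have "x = L (restrict u B)" by (simp add: L_def)
      then show "x \<in> L ` (B \<rightarrow>\<^sub>E UNIV)" by (auto simp: image_iff intro!: bexI[of _ "restrict u B"])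
    qed
  qed
  \<comment> \<open>S fixes each element of B, so semilinearity leaves only the action of \<sigma>
    on the coordinates.\<close>
  have SL: "S (L c) = L (restrict (\<lambda>b. \<sigma> (c b)) B)" for c
  proof -
    have "S (L c) = (\<Sum>b\<in>B. scale (\<sigma> (c b)) (S b))"
      unfolding L_def using BE
      by (subst S_sum) (auto simp: finB S_scale subset_iff intro!: V.subspace_scale[OF sub])
    also have "\<dots> = L (restrict (\<lambda>b. \<sigma> (c b)) B)"
      unfolding L_def using B(1) by (intro sum.cong) (auto simp: W_def)
    finally show ?thesis .
  qed
  have imW: "L ` (B \<rightarrow>\<^sub>E fixed) = W"
  proof
    show "L ` (B \<rightarrow>\<^sub>E fixed) \<subseteq> W"
    proof clarify
      fix c assume c: "c \<in> B \<rightarrow>\<^sub>E fixed"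
      have "restrict (\<lambda>b. \<sigma> (c b)) B = c"
        using c by (auto simp: fixed_def restrict_def fun_eq_iff PiE_iff extensional_def)
      then have "S (L c) = L c" using SL[of c] by simp
      moreover have "L c \<in> E" using imE c by (auto simp: PiE_def)
      ultimately show "L c \<in> W" by (simp add: W_def)
    qed
    show "W \<subseteq> L ` (B \<rightarrow>\<^sub>E fixed)"
    proof
      fix x assume x: "x \<in> W"
      then have "x \<in> L ` (B \<rightarrow>\<^sub>E UNIV)" using imE by (auto simp: W_def)
      then obtain c where c: "c \<in> B \<rightarrow>\<^sub>E UNIV" "x = L c" by blast
      have "L (restrict (\<lambda>b. \<sigma> (c b)) B) = L c" using SL[of c] x c(2) by (simp add: W_def)
      then have eq: "restrict (\<lambda>b. \<sigma> (c b)) B = c"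
        using inj_onD[OF inj _ _ c(1)] by simp
      have "c b \<in> fixed" if "b \<in> B" for b
        using fun_cong[OF eq, of b] that by (simp add: fixed_def)
      then have "c \<in> B \<rightarrow>\<^sub>E fixed" using c(1) by (auto simp: PiE_iff)
      then show "x \<in> L ` (B \<rightarrow>\<^sub>E fixed)" using c(2) by blast
    qed
  qed
  have "card E = card (UNIV :: 'a set) ^ card B"
    unfolding imE[symmetric] card_image[OF inj] by (simp add: card_PiE finB)
  moreover have "card W = card fixed ^ card B"
    unfolding imW[symmetric] card_image[OF inj_on_subset[OF inj, of "B \<rightarrow>\<^sub>E fixed", simplified]]
    by (subst card_image, rule inj_on_subset[OF inj]) (auto simp: card_PiE finB PiE_iff)
  ultimately show ?thesis using that unfolding W_def by blast
qed

end

subsection \<open>The Galois group of a finite field\<close>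

lemma ring_iso_type_algebra_iff:
  fixes \<tau> :: "'a::field \<Rightarrow> 'a"
  shows "\<tau> \<in> ring_iso ring_of_type_algebra ring_of_type_algebra \<longleftrightarrow>
    bij \<tau> \<and> \<tau> 1 = 1 \<and> (\<forall>x y. \<tau> (x + y) = \<tau> x + \<tau> y) \<and> (\<forall>x y. \<tau> (x * y) = \<tau> x * \<tau> y)"
  by (auto simp: ring_iso_def Ring.ring_hom_def ring_of_type_algebra_def)

lemma carrier_galois_group:
  fixes \<tau> :: "'a::field \<Rightarrow> 'a"
  shows "\<tau> \<in> carrier (galois_group F) \<longleftrightarrow>
    bij \<tau> \<and> \<tau> 1 = 1 \<and> (\<forall>x y. \<tau> (x + y) = \<tau> x + \<tau> y) \<and> (\<forall>x y. \<tau> (x * y) = \<tau> x * \<tau> y)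
    \<and> (\<forall>x\<in>F. \<tau> x = x)"
  by (auto simp: galois_group_def ring_iso_type_algebra_iff)

lemma galois_group_simps [simp]:
  "x \<otimes>\<^bsub>galois_group F\<^esub> y = x \<circ> y" "\<one>\<^bsub>galois_group F\<^esub> = id"
  by (simp_all add: galois_group_def)

lemma group_galois_group: "group (galois_group (F :: 'a::field set))"
proof (rule groupI)
  fix \<tau> :: "'a \<Rightarrow> 'a"
  let ?i = "inv_into UNIV \<tau>"
  assume t: "\<tau> \<in> carrier (galois_group F)"
  then have "bij \<tau>" by (simp add: carrier_galois_group)
  then have ii: "\<And>x. \<tau> (?i x) = x" "\<And>x. ?i (\<tau> x) = x" "bij (?i)"
    by (auto simp: bij_is_surj surj_f_inv_f bij_is_inj bij_imp_bij_inv)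
  have "?i \<in> carrier (galois_group F)"
    unfolding carrier_galois_group
  proof (intro conjI allI ballI)
    have h: "\<tau> 1 = 1" "\<And>x y. \<tau> (x + y) = \<tau> x + \<tau> y" "\<And>x y. \<tau> (x * y) = \<tau> x * \<tau> y"
      "\<And>x. x \<in> F \<Longrightarrow> \<tau> x = x"
      using t by (auto simp: carrier_galois_group)
    show "?i 1 = 1" using ii(2)[of 1] h(1) by simp
    show "?i x = x" if "x \<in> F" for x using ii(2)[of x] h(4)[OF that] by simp
    show "?i (x + y) = ?i x + ?i y" for x y
      using ii(2)[of "?i x + ?i y"] by (simp add: h(2) ii(1))
    show "?i (x * y) = ?i x * ?i y" for x y
      using ii(2)[of "?i x * ?i y"] by (simp add: h(3) ii(1))
  qed (rule ii)
  then show "\<exists>y\<in>carrier (galois_group F). y \<otimes>\<^bsub>galois_group F\<^esub> \<tau> = \<one>\<^bsub>galois_group F\<^esub>"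
    by (intro bexI[of _ "?i"]) (auto simp: ii)
next
  fix \<tau> \<upsilon> :: "'a \<Rightarrow> 'a"
  assume "\<tau> \<in> carrier (galois_group F)" "\<upsilon> \<in> carrier (galois_group F)"
  then show "\<tau> \<otimes>\<^bsub>galois_group F\<^esub> \<upsilon> \<in> carrier (galois_group F)"
    unfolding carrier_galois_group by (simp add: bij_comp)
next
  show "\<one>\<^bsub>galois_group F\<^esub> \<in> carrier (galois_group F)"
    unfolding carrier_galois_group by simp
qed (simp_all only: galois_group_simps o_assoc id_comp)

lemma generate_fixes:
  assumes "\<sigma> \<in> carrier (galois_group F)" "\<tau> \<in> generate (galois_group F) {\<sigma>}" "\<sigma> x = x"
  shows "\<tau> x = x"
  using assms(2)
proof induction
  case (inv h)
  interpret group "galois_group F" by (rule group_galois_group)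
  have "inv\<^bsub>galois_group F\<^esub> \<sigma> \<circ> \<sigma> = id" using l_inv[OF assms(1)] by simp
  then have "(inv\<^bsub>galois_group F\<^esub> \<sigma>) (\<sigma> x) = x" by (metis comp_apply id_apply)
  then show ?case using inv assms(3) by simp
qed (use assms(3) in auto)

section \<open>The Frobenius map and the fixed field of a generator\<close>

lemma frobenius_add:
  fixes x y :: "'a::{field,finite}"
  assumes "primepow q" "card (UNIV :: 'a set) = q ^ n"
  shows "(x + y) ^ q = x ^ q + y ^ q"
proof -
  obtain p e where pe: "prime p" "e > 0" "q = p ^ e"
    using assms(1) by (auto simp: primepow_def)
  have "prime CHAR('a)"
    by (intro prime_CHAR_semidom finite_imp_CHAR_pos) simp
  moreover have "CHAR('a) dvd p ^ (e * n)"
    using CHAR_dvd_CARD[where ?'a = 'a] assms(2) pe by (simp add: power_mult)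
  ultimately have "CHAR('a) = p" using pe(1) using prime_dvd_power[of "CHAR('a)" p "e * n"] primes_dvd_imp_eq[of "CHAR('a)" p] by blast
  then show ?thesis using pe(3) \<open>prime CHAR('a)\<close> by (intro freshmans_dream') simp_all
qed

text \<open>Multiplication by a nonzero x permutes the nonzero elements of F; comparing their
  product before and after gives the exponent.\<close>

lemma power_card_subfield:
  fixes x :: "'a::{field,finite}"
  assumes "is_subfield F" "x \<in> F"
  shows "x ^ card F = x"
proof (cases "x = 0")
  case True
  have "card F > 0" using assms(2) by (auto simp: card_gt_0_iff)
  then show ?thesis using True by simp
next
  case False
  have sub: "subring F (ring_of_type_algebra :: 'a ring)"
    using assms(1) unfolding is_subfield_def by (rule subfieldE(1))
  have mult: "a * b \<in> F" if "a \<in> F" "b \<in> F" for a b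
    using subringE(6)[OF sub that] by (simp add: ring_of_type_algebra_def)
  have zero: "0 \<in> F" using subringE(2)[OF sub] by (simp add: ring_of_type_algebra_def)
  have "(\<lambda>y. x * y) ` (F - {0}) = F - {0}"
    by (rule endo_inj_surj) (use False assms(2) mult in \<open>auto simp: inj_on_def\<close>)
  then have "(\<Prod>y\<in>F - {0}. y) = (\<Prod>y\<in>(\<lambda>y. x * y) ` (F - {0}). y)" by simp
  also have "\<dots> = (\<Prod>y\<in>F - {0}. x * y)"
    using False by (subst prod.reindex) (auto simp: inj_on_def)
  also have "\<dots> = x ^ card (F - {0}) * (\<Prod>y\<in>F - {0}. y)"
    by (simp add: prod.distrib)
  finally have "x ^ card (F - {0}) = 1" by simp
  moreover have "card F = Suc (card (F - {0}))" using zero by (intro card.remove) auto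
  ultimately show ?thesis by (simp only: power_Suc mult_1_right)
qed

lemma card_power_eq_self_le:
  assumes "q > 1"
  shows "card {x :: 'a::{field,finite}. x ^ q = x} \<le> q"
proof -
  let ?p = "monom 1 q - monom 1 1 :: 'a poly"
  have deg: "degree ?p \<le> q" using assms by (intro degree_diff_le) (auto intro: order.trans[OF degree_monom_le])
  have "coeff ?p q = 1" using assms by (simp add: coeff_monom)
  then have "?p \<noteq> 0" by (metis coeff_0 zero_neq_one)
  then have "card {x. poly ?p x = 0} \<le> degree ?p" by (rule poly_roots_degree)
  moreover have "{x. poly ?p x = 0} = {x. x ^ q = x}" by (simp add: poly_monom)
  ultimately show ?thesis using deg by simp
qed

text \<open>The Frobenius map lies in the group generated by \<sigma>, so it fixes whatever \<sigma>
  fixes; but it has at most q fixed points, and F already supplies q.\<close>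

lemma fixed_points_of_generator:
  fixes \<sigma> :: "'a::{field,finite} \<Rightarrow> 'a"
  assumes "primepow q" "card (UNIV :: 'a set) = q ^ n" "is_subfield F" "card F = q"
    and gen: "generates_galois_group \<sigma> F"
  shows "{x. \<sigma> x = x} = F"
proof
  show "F \<subseteq> {x. \<sigma> x = x}"
    using gen by (auto simp: generates_galois_group_def carrier_galois_group)
  have q1: "q > 1" using primepow_gt_Suc_0[OF assms(1)] by simp
  let ?\<phi> = "\<lambda>x :: 'a. x ^ q"
  have "inj ?\<phi>"
  proof (rule injI)
    fix x y :: 'a assume eq: "x ^ q = y ^ q"
    have "x ^ q = (x - y) ^ q + y ^ q" using frobenius_add[OF assms(1,2), of "x - y" y] by simp
    then show "x = y" using eq by simp
  qed
  then have "bij ?\<phi>" by (simp add: bij_betw_def finite_UNIV_inj_surj)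
  then have "?\<phi> \<in> carrier (galois_group F)"
    using frobenius_add[OF assms(1,2)] power_card_subfield[OF assms(3)] assms(4)
    by (simp add: carrier_galois_group power_mult_distrib)
  then have phi: "?\<phi> \<in> generate (galois_group F) {\<sigma>}"
    using gen by (simp add: generates_galois_group_def)
  have "{x. \<sigma> x = x} \<subseteq> {x. x ^ q = x}"
    using generate_fixes[OF _ phi] gen by (auto simp: generates_galois_group_def)
  also have "{x. x ^ q = x} = F"
  proof (rule sym, rule card_seteq)
    show "F \<subseteq> {x. x ^ q = x}" using power_card_subfield[OF assms(3)] assms(4) by auto
    show "card {x :: 'a. x ^ q = x} \<le> card F"
      using card_power_eq_self_le[OF q1] assms(4) by simp
  qed simp
  finally show "{x. \<sigma> x = x} \<subseteq> F" .
qed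

text \<open>Supplies the exact order of \<sigma> before anything relates it to the degree of the
  extension.\<close>

lemma finite_order_bij:
  fixes \<sigma> :: "'a::finite \<Rightarrow> 'a"
  assumes "bij \<sigma>"
  obtains m where "m > 0" "\<sigma> ^^ m = id" "inj_on (\<lambda>i. \<sigma> ^^ i) {..<m}"
proof -
  have diff: "\<sigma> ^^ (j - i) = id" if "i < j" "\<sigma> ^^ i = \<sigma> ^^ j" for i j :: nat
  proof
    fix x
    have "(\<sigma> ^^ i) ((\<sigma> ^^ (j - i)) x) = (\<sigma> ^^ (i + (j - i))) x"
      by (simp only: funpow_add comp_apply)
    also have "\<dots> = (\<sigma> ^^ i) x" using that by simp
    finally show "(\<sigma> ^^ (j - i)) x = id x"
      using inj_fn[OF bij_is_inj[OF assms], of i] by (simp add: inj_eq)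
  qed
  have "\<not> inj (\<lambda>i::nat. \<sigma> ^^ i)"
    using finite_imageD[of "\<lambda>i::nat. \<sigma> ^^ i" UNIV] by auto
  then obtain i j :: nat where "i < j" "\<sigma> ^^ i = \<sigma> ^^ j"
    by (auto simp: inj_def) (metis linorder_neqE_nat)
  then have ex: "\<exists>m. m > 0 \<and> \<sigma> ^^ m = id" using diff by (intro exI[of _ "j - i"]) auto
  define m where "m = (LEAST m. m > 0 \<and> \<sigma> ^^ m = id)"
  have m: "m > 0" "\<sigma> ^^ m = id" using LeastI_ex[OF ex] by (auto simp: m_def)
  have nle: "\<not> i < j" if "j < m" "\<sigma> ^^ i = \<sigma> ^^ j" for i j
  proof
    assume "i < j"
    then have "m \<le> j - i" unfolding m_def using diff[OF _ that(2)] by (intro Least_le) auto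
    then show False using \<open>i < j\<close> \<open>j < m\<close> by simp
  qed
  have "inj_on (\<lambda>i. \<sigma> ^^ i) {..<m}"
    by (rule inj_onI) (metis nle lessThan_iff linorder_neqE_nat)
  with m show ?thesis by (rule that)
qed

subsection \<open>Left kernels and geometric multiplicities\<close>

lemma kernel_dim_echelon:
  fixes A :: "'a::field mat"
  assumes A: "A \<in> carrier_mat nr nc" and P: "P \<in> carrier_mat nr nr" and Q: "Q \<in> carrier_mat nr nr"
    and QP: "Q * P = 1\<^sub>m nr" and ref: "row_echelon_form (P * A)"
  shows "kernel_dim A = nc - card {i. i < nr \<and> row (P * A) i \<noteq> 0\<^sub>v nc}"
proof -
  have "P * A \<in> carrier_mat nr nc" using P A by simp
  from find_base_vectors(6)[OF ref this] mat_kernel_mult_eq[OF A P Q QP]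
  show ?thesis using A by (simp add: kernel_dim_def)
qed

lemma echelon_transformation:
  fixes A :: "'a::field mat"
  assumes A: "A \<in> carrier_mat nr nc"
  obtains P Q where "P \<in> carrier_mat nr nr" "Q \<in> carrier_mat nr nr" "P * Q = 1\<^sub>m nr"
    "Q * P = 1\<^sub>m nr" "row_echelon_form (P * A)"
  using gauss_jordan_single(3,4)[OF A refl] by metis

text \<open>The dimension can be read off an echelon form, and a field homomorphism carries the
  transformation, its inverse and the pivots along.\<close>

lemma (in field_hom) kernel_dim_hom:
  assumes A: "A \<in> carrier_mat nr nc"
  shows "kernel_dim (map_mat hom A) = kernel_dim A"
proof -
  obtain P Q where PQ: "P \<in> carrier_mat nr nr" "Q \<in> carrier_mat nr nr"
    "Q * P = 1\<^sub>m nr" "row_echelon_form (P * A)"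
    using echelon_transformation[OF A] by metis
  have PA: "P * A \<in> carrier_mat nr nc" using PQ A by simp
  have hPA: "map_mat hom P * map_mat hom A = map_mat hom (P * A)"
    using mat_hom_mult[OF PQ(1) A] by simp
  have "map_mat hom Q * map_mat hom P = 1\<^sub>m nr"
    using mat_hom_mult[OF PQ(2,1)] PQ(3) mat_hom_one by simp
  moreover have "row_echelon_form (map_mat hom (P * A))"
  proof -
    obtain f where "pivot_fun (P * A) f nc"
      using PQ(4) A by (auto simp: row_echelon_form_def)
    note f = pivot_funD[OF carrier_matD(1)[OF PA] this]
    have "pivot_fun (map_mat hom (P * A)) f nc"
    proof (rule pivot_funI[of _ nr])
      fix i j assume i: "i < nr" and j: "j < f i"
      then show "map_mat hom (P * A) $$ (i, j) = 0" using f(1)[of i] f(2)[of i j] A PQ(1) by simp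
    next
      fix i i' assume "i < nr" "f i < nc" "i' < nr" "i' \<noteq> i"
      then show "map_mat hom (P * A) $$ (i', f i) = 0" using f(5)[of i i'] A PQ(1) by simp
    next
      fix i assume "i < nr" "f i < nc"
      then show "map_mat hom (P * A) $$ (i, f i) = 1" using f(4)[of i] A PQ(1) by simp
    qed (use f PQ in auto)
    then show ?thesis using A by (auto simp: row_echelon_form_def)
  qed
  ultimately have "kernel_dim (map_mat hom A)
      = nc - card {i. i < nr \<and> row (map_mat hom (P * A)) i \<noteq> 0\<^sub>v nc}"
    using kernel_dim_echelon[of "map_mat hom A" nr nc "map_mat hom P" "map_mat hom Q"] A PQ
    by (simp add: hPA)
  also have "{i. i < nr \<and> row (map_mat hom (P * A)) i \<noteq> 0\<^sub>v nc}
      = {i. i < nr \<and> row (P * A) i \<noteq> 0\<^sub>v nc}"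
    using A PQ(1) by (intro Collect_cong conj_cong refl) (auto simp: vec_eq_iff row_def)
  also have "nc - card \<dots> = kernel_dim A"
    using kernel_dim_echelon[OF A PQ] by simp
  finally show ?thesis .
qed

text \<open>Counting zero rows is the form of the nullity that serves both uses below: the bound by
  the algebraic multiplicity and the size of the left kernel.\<close>

lemma kernel_dim_square:
  fixes A :: "'a::field mat"
  assumes A: "A \<in> carrier_mat n n" and P: "P \<in> carrier_mat n n" and Q: "Q \<in> carrier_mat n n"
    and QP: "Q * P = 1\<^sub>m n" and ref: "row_echelon_form (P * A)"
  shows "kernel_dim A = card {i. i < n \<and> row (P * A) i = 0\<^sub>v n}"
proof -
  have "card {i. i < n \<and> row (P * A) i = 0\<^sub>v n} = card ({..<n} - {i. i < n \<and> row (P * A) i \<noteq> 0\<^sub>v n})"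
    by (rule arg_cong[where f = card]) auto
  also have "\<dots> = n - card {i. i < n \<and> row (P * A) i \<noteq> 0\<^sub>v n}"
    by (subst card_Diff_subset) auto
  finally show ?thesis using kernel_dim_echelon[OF assms] by simp
qed

text \<open>Conjugate A by the matrix P that brings A - e I to echelon form. Each zero row of the
  echelon form becomes a row of the conjugate with e on the diagonal and 0 elsewhere, and so
  contributes one factor X - e to the characteristic polynomial.\<close>

lemma kernel_dim_le_order:
  fixes A :: "'a::field mat"
  assumes A: "A \<in> carrier_mat n n"
  shows "kernel_dim (char_matrix A e) \<le> Polynomial.order e (char_poly A)"
proof -
  let ?B = "char_matrix A e"
  have B: "?B \<in> carrier_mat n n" using A by simp
  obtain P Q where P: "P \<in> carrier_mat n n" and Q: "Q \<in> carrier_mat n n" and PQ: "P * Q = 1\<^sub>m n"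
    and QP: "Q * P = 1\<^sub>m n" and ref: "row_echelon_form (P * ?B)"
    by (rule echelon_transformation[OF B])
  define Z where "Z = {i. i < n \<and> row (P * ?B) i = 0\<^sub>v n}"
  define A' where "A' = P * A * Q"
  have A': "A' \<in> carrier_mat n n" using A P Q by (simp add: A'_def)
  have sim: "similar_mat A' A"
    unfolding similar_mat_def A'_def
    by (intro exI[of _ P] exI[of _ Q] similar_mat_witI[OF PQ QP refl]) (use A P Q in auto)
  have A'eq: "A' = P * ?B * Q + e \<cdot>\<^sub>m 1\<^sub>m n"
  proof -
    have "A = ?B + e \<cdot>\<^sub>m 1\<^sub>m n" using A by (intro eq_matI) (auto simp: char_matrix_def)
    then have "A' = P * (?B + e \<cdot>\<^sub>m 1\<^sub>m n) * Q" by (simp add: A'_def)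
    also have "P * (?B + e \<cdot>\<^sub>m 1\<^sub>m n) = P * ?B + e \<cdot>\<^sub>m P"
      using P B by (subst mult_add_distrib_mat[of _ n n _ n]) (auto simp: mult_smult_distrib[of P n n])
    also have "\<dots> * Q = P * ?B * Q + (e \<cdot>\<^sub>m P) * Q"
      using P B Q by (subst add_mult_distrib_mat[of _ n n]) auto
    also have "(e \<cdot>\<^sub>m P) * Q = e \<cdot>\<^sub>m 1\<^sub>m n"
      using P Q PQ by (simp add: mult_smult_assoc_mat[of P n n])
    finally show ?thesis .
  qed
  have rowZ: "A' $$ (i, j) = (if i = j then e else 0)" if "i \<in> Z" "j < n" for i j
  proof -
    define R where "R = P * ?B"
    have R: "R \<in> carrier_mat n n" using P B by (simp add: R_def)
    have i: "i < n" "row R i = 0\<^sub>v n" using that by (auto simp: Z_def R_def)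
    have "(R * Q) $$ (i, j) = row R i \<bullet> col Q j"
      using i that R Q by simp
    also have "\<dots> = 0" using Q that unfolding i(2) by simp
    finally show ?thesis using i that R Q by (simp add: A'eq flip: R_def)
  qed
  \<comment> \<open>The rows in Z are divisible by X - e: D collects these factors, and M is what
    remains of the characteristic matrix.\<close>
  define D where "D = mat_diag n (\<lambda>i. if i \<in> Z then [:- e, 1:] else 1)"
  define M where "M = mat n n (\<lambda>(i, j). if i \<in> Z then (if i = j then 1 else 0) else char_poly_matrix A' $$ (i, j))"
  have M: "M \<in> carrier_mat n n" by (simp add: M_def)
  have D: "D \<in> carrier_mat n n" by (simp add: D_def)
  have "char_poly_matrix A' = D * M"
    unfolding D_def mat_diag_mult_left[OF M]
    using A' by (intro eq_matI) (auto simp: M_def char_poly_matrix_def rowZ one_pCons)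
  then have "char_poly A = det D * det M"
    using char_poly_similar[OF sim] det_mult[OF D M] by (simp add: char_poly_def)
  moreover have "det D = (\<Prod>i<n. if i \<in> Z then [:- e, 1:] else 1)"
    by (subst det_upper_triangular[OF _ D])
      (auto simp: prod_list_diag_prod D_def mat_diag_def atLeast0LessThan)
  moreover have "\<dots> = [:- e, 1:] ^ card Z"
    by (subst prod.inter_filter[symmetric]) (auto simp: Z_def)
  ultimately have "[:- e, 1:] ^ card Z dvd char_poly A" by simp
  moreover have "char_poly A \<noteq> 0" using degree_monic_char_poly[OF A] by auto
  ultimately have "card Z \<le> Polynomial.order e (char_poly A)"
    by (simp add: order_divides)
  then show ?thesis using kernel_dim_square[OF B P Q QP ref] by (simp add: Z_def)
qed

text \<open>
  A row vector of length \<open>n\<close> is a function on \<open>nat\<close> that vanishes from \<open>n\<close> on, so that row vectors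
  form a subspace of a type.
\<close>

definition lmul :: "nat \<Rightarrow> (nat \<Rightarrow> 'a::comm_ring_1) \<Rightarrow> 'a mat \<Rightarrow> nat \<Rightarrow> 'a" where
  "lmul n w A j = (if j < n then \<Sum>i<n. w i * A $$ (i, j) else 0)"

lemma lmul_mult:
  assumes "A \<in> carrier_mat n n" "B \<in> carrier_mat n n"
  shows "lmul n w (A * B) = lmul n (lmul n w A) B"
proof
  fix j show "lmul n w (A * B) j = lmul n (lmul n w A) B j"
  proof (cases "j < n")
    case True
    have "(\<Sum>i<n. w i * (A * B) $$ (i, j)) = (\<Sum>i<n. \<Sum>k<n. w i * (A $$ (i, k) * B $$ (k, j)))"
      using assms True by (intro sum.cong) (auto simp: scalar_prod_def sum_distrib_left atLeast0LessThan)
    also have "\<dots> = (\<Sum>k<n. \<Sum>i<n. w i * (A $$ (i, k) * B $$ (k, j)))"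
      by (rule sum.swap)
    also have "\<dots> = (\<Sum>k<n. (\<Sum>i<n. w i * A $$ (i, k)) * B $$ (k, j))"
      by (simp add: sum_distrib_right mult.assoc)
    finally show ?thesis using True by (simp add: lmul_def)
  qed (simp add: lmul_def)
qed

lemma lmul_one:
  assumes "\<And>i. i \<ge> n \<Longrightarrow> w i = 0"
  shows "lmul n w (1\<^sub>m n) = w"
proof
  fix j
  have "(\<Sum>i<n. w i * 1\<^sub>m n $$ (i, j)) = (\<Sum>i<n. if i = j then w i else 0)" if "j < n"
    using that by (intro sum.cong) auto
  then show "lmul n w (1\<^sub>m n) j = w j" using assms[of j] by (auto simp: lmul_def)
qed

lemma lmul_add: "lmul n (\<lambda>i. v i + w i) A = (\<lambda>i. lmul n v A i + lmul n w A i)"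
  by (auto simp: lmul_def sum.distrib algebra_simps)

lemma lmul_scale: "lmul n (\<lambda>i. c * w i) A = (\<lambda>i. c * lmul n w A i)"
  by (auto simp: lmul_def sum_distrib_left algebra_simps)

lemma lmul_char_matrix:
  assumes "A \<in> carrier_mat n n" "\<And>i. i \<ge> n \<Longrightarrow> w i = 0"
  shows "lmul n w (char_matrix A e) = (\<lambda>i. lmul n w A i - e * w i)"
proof
  fix j
  have "(\<Sum>i<n. w i * char_matrix A e $$ (i, j)) = (\<Sum>i<n. w i * A $$ (i, j) - (if i = j then e * w i else 0))"
    if "j < n"
    using assms(1) that by (intro sum.cong) (auto simp: char_matrix_def algebra_simps)
  then show "lmul n w (char_matrix A e) j = lmul n w A j - e * w j"
    using assms(2)[of j] by (auto simp: lmul_def sum_subtractf)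
qed

lemma vector_space_fun: "vector_space (\<lambda>(c::'a::field) (f::nat \<Rightarrow> 'a) i. c * f i)"
  by unfold_locales (auto simp: algebra_simps fun_eq_iff)

lemma subspace_funI:
  assumes "(\<lambda>_. 0) \<in> E" "\<And>f g. f \<in> E \<Longrightarrow> g \<in> E \<Longrightarrow> (\<lambda>i. f i + g i) \<in> E"
    and "\<And>c f. f \<in> E \<Longrightarrow> (\<lambda>i. c * f i) \<in> E"
  shows "module.subspace (\<lambda>(c::'a::field) (f::nat \<Rightarrow> 'a) i. c * f i) E"
proof -
  interpret V: vector_space "\<lambda>(c::'a::field) (f::nat \<Rightarrow> 'a) i. c * f i" by (rule vector_space_fun)
  show ?thesis using assms by (intro V.subspaceI) (auto simp: zero_fun_def plus_fun_def)
qed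

lemma bij_betw_supported:
  "bij_betw (\<lambda>f i. if i \<in> I then f i else 0) (I \<rightarrow>\<^sub>E UNIV) {f :: 'i \<Rightarrow> 'a::{zero,finite}. \<forall>i. i \<notin> I \<longrightarrow> f i = 0}"
  by (rule bij_betw_byWitness[where f' = "\<lambda>f. restrict f I"]) (auto simp: fun_eq_iff PiE_iff extensional_def)

lemma card_supported:
  assumes "finite I"
  shows "card {f :: 'i \<Rightarrow> 'a::{zero,finite}. \<forall>i. i \<notin> I \<longrightarrow> f i = 0} = card (UNIV :: 'a set) ^ card I"
  by (subst bij_betw_same_card[OF bij_betw_supported, symmetric]) (simp add: card_PiE assms)

lemma finite_supported:
  assumes "finite I"
  shows "finite {f :: 'i \<Rightarrow> 'a::{zero,finite}. \<forall>i. i \<notin> I \<longrightarrow> f i = 0}"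
  by (subst bij_betw_finite[OF bij_betw_supported, symmetric]) (simp add: finite_PiE assms)

text \<open>\<open>kernel_dim\<close> measures the right kernel, so this is the equality of row and
  column rank in counting form. Multiplication by the inverse of P carries the left kernel of A to
  that of its echelon form, which consists of the vectors supported on the zero rows.\<close>

lemma card_left_kernel:
  fixes A :: "'a::{field,finite} mat"
  assumes A: "A \<in> carrier_mat n n"
  shows "card {w. (\<forall>i\<ge>n. w i = 0) \<and> lmul n w A = (\<lambda>_. 0)} = card (UNIV :: 'a set) ^ kernel_dim A"
proof -
  obtain P Q where P: "P \<in> carrier_mat n n" and Q: "Q \<in> carrier_mat n n" and PQ: "P * Q = 1\<^sub>m n"
    and QP: "Q * P = 1\<^sub>m n" and ref: "row_echelon_form (P * A)"
    by (rule echelon_transformation[OF A])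
  define R where "R = P * A"
  have R: "R \<in> carrier_mat n n" using P A by (simp add: R_def)
  obtain f where "pivot_fun R f n"
    using ref R by (auto simp: row_echelon_form_def R_def)
  note piv = pivot_fun_zero_row_iff[OF this R] pivot_funD[OF carrier_matD(1)[OF R] this]
  define Z where "Z = {i. i < n \<and> row R i = 0\<^sub>v n}"
  have kerR: "(\<forall>i\<ge>n. z i = 0) \<and> lmul n z R = (\<lambda>_. 0) \<longleftrightarrow> (\<forall>i. i \<notin> Z \<longrightarrow> z i = 0)" for z
  proof
    assume z: "(\<forall>i\<ge>n. z i = 0) \<and> lmul n z R = (\<lambda>_. 0)"
    show "\<forall>i. i \<notin> Z \<longrightarrow> z i = 0"
    proof (intro allI impI)
      fix i assume "i \<notin> Z"
      show "z i = 0"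
      proof (cases "i < n")
        case True
        then have fi: "f i < n" using \<open>i \<notin> Z\<close> piv(1,2)[OF True] by (force simp: Z_def)
        \<comment> \<open>Column \<open>f i\<close> of the echelon form is the i-th unit vector, so
          this entry of the product is \<open>z i\<close> itself.\<close>
        have "0 = (\<Sum>k<n. z k * R $$ (k, f i))"
          using z fi by (metis lmul_def)
        also have "\<dots> = (\<Sum>k<n. if k = i then z k else 0)"
          using fi piv(5,6)[OF True fi] True by (intro sum.cong) auto
        also have "\<dots> = z i" using True by simp
        finally show ?thesis by simp
      qed (use z in auto)
    qed
  next
    assume z: "\<forall>i. i \<notin> Z \<longrightarrow> z i = 0"
    have zR: "z k * R $$ (k, j) = 0" if "k < n" "j < n" for k j
    proof (cases "k \<in> Z")
      case True
      then have "row R k $ j = 0" using that by (auto simp: Z_def)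
      then show ?thesis using that R by simp
    qed (use z in simp)
    have "(\<Sum>k<n. z k * R $$ (k, j)) = 0" if "j < n" for j
      by (rule sum.neutral) (use zR that in auto)
    then have "lmul n z R = (\<lambda>_. 0)" by (intro ext) (simp add: lmul_def)
    moreover have "\<forall>i\<ge>n. z i = 0" using z by (auto simp: Z_def)
    ultimately show "(\<forall>i\<ge>n. z i = 0) \<and> lmul n z R = (\<lambda>_. 0)" by simp
  qed
  have "bij_betw (\<lambda>w. lmul n w Q) {w. (\<forall>i\<ge>n. w i = 0) \<and> lmul n w A = (\<lambda>_. 0)}
      {z. (\<forall>i\<ge>n. z i = 0) \<and> lmul n z R = (\<lambda>_. 0)}"
  proof (rule bij_betw_byWitness[where f' = "\<lambda>z. lmul n z P"])
    show "\<forall>w\<in>{w. (\<forall>i\<ge>n. w i = 0) \<and> lmul n w A = (\<lambda>_. 0)}. lmul n (lmul n w Q) P = w"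
      using P Q by (auto simp flip: lmul_mult simp: QP lmul_one)
    show "\<forall>z\<in>{z. (\<forall>i\<ge>n. z i = 0) \<and> lmul n z R = (\<lambda>_. 0)}. lmul n (lmul n z P) Q = z"
      using P Q by (auto simp flip: lmul_mult simp: PQ lmul_one)
    have "Q * R = A" using P Q A QP unfolding R_def by (subst assoc_mult_mat[symmetric, of _ n n _ n _ n]) auto
    then show "(\<lambda>w. lmul n w Q) ` {w. (\<forall>i\<ge>n. w i = 0) \<and> lmul n w A = (\<lambda>_. 0)}
        \<subseteq> {z. (\<forall>i\<ge>n. z i = 0) \<and> lmul n z R = (\<lambda>_. 0)}"
      using Q R by (auto simp flip: lmul_mult) (simp add: lmul_def)
    show "(\<lambda>z. lmul n z P) ` {z. (\<forall>i\<ge>n. z i = 0) \<and> lmul n z R = (\<lambda>_. 0)}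
        \<subseteq> {w. (\<forall>i\<ge>n. w i = 0) \<and> lmul n w A = (\<lambda>_. 0)}"
      using P A unfolding R_def by (auto simp flip: lmul_mult) (simp add: lmul_def)
  qed
  from bij_betw_same_card[OF this] show ?thesis
    unfolding kerR using card_supported[of Z, where ?'a = 'a]
    by (simp add: Z_def R_def kernel_dim_square[OF A P Q QP ref])
qed

subsection \<open>The norm of a cyclic extension\<close>

context cyclic_automorphism begin

lemma card_fixed_gt_1: "card fixed > 1"
proof -
  have "{0, 1} \<subseteq> fixed" by (auto simp: fixed_def hom_zero hom_one)
  from card_mono[OF _ this] show ?thesis by simp
qed

text \<open>
  Descent applied to the functions on the cyclic group of order \<open>n\<close>, on which \<open>\<sigma>\<close> acts by
  shifting the argument and applying \<open>\<sigma>\<close> to the values: a fixed function is determined by its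
  value at \<open>0\<close>.
\<close>

lemma card_UNIV_eq: "card (UNIV :: 'a set) = card fixed ^ n"
proof -
  define E where "E = {f :: nat \<Rightarrow> 'a. \<forall>i. i \<notin> {..<n} \<longrightarrow> f i = 0}"
  \<comment> \<open>Adding \<open>n - 1\<close> modulo n is the backward shift, written without
    subtraction so that it also wraps around at index 0.\<close>
  define S where "S f = (\<lambda>i. if i < n then \<sigma> (f ((i + (n - 1)) mod n)) else 0)" for f :: "nat \<Rightarrow> 'a"
  let ?sc = "\<lambda>(c::'a) (f::nat \<Rightarrow> 'a) i. c * f i"
  have Sk: "(S ^^ k) f i = (\<sigma> ^^ k) (f ((i + k * (n - 1)) mod n))" if "f \<in> E" "i < n" for k f i
    using that(2)
  proof (induction k arbitrary: i)
    case (Suc k)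
    have "(S ^^ Suc k) f i = \<sigma> ((S ^^ k) f ((i + (n - 1)) mod n))"
      using Suc.prems by (simp add: S_def)
    also have "\<dots> = \<sigma> ((\<sigma> ^^ k) (f (((i + (n - 1)) mod n + k * (n - 1)) mod n)))"
      using n_pos by (subst Suc.IH) auto
    also have "((i + (n - 1)) mod n + k * (n - 1)) mod n = (i + Suc k * (n - 1)) mod n"
      by (simp add: mod_add_left_eq add.assoc)
    finally show ?case by simp
  qed simp
  have SE: "S f \<in> E" for f by (auto simp: S_def E_def)
  have Sn: "(S ^^ n) f = f" if f: "f \<in> E" for f
  proof
    fix i show "(S ^^ n) f i = f i"
    proof (cases "i < n")
      case True
      then show ?thesis using Sk[OF f True, of n] by (simp add: funpow_n)
    next
      case False
      have "(S ^^ n) f \<in> E" using n_pos SE by (cases n) auto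
      then show ?thesis using f False by (simp add: E_def)
    qed
  qed
  obtain k where k: "card E = card (UNIV :: 'a set) ^ k" "card {f \<in> E. S f = f} = card fixed ^ k"
  proof (rule descent[OF vector_space_fun, of E S])
    show "module.subspace ?sc E" by (rule subspace_funI) (auto simp: E_def)
    show "finite E" unfolding E_def by (rule finite_supported) simp
    show "S f \<in> E" if "f \<in> E" for f by (rule SE)
    show "(S ^^ n) f = f" if "f \<in> E" for f by (rule Sn[OF that])
  qed (use that in \<open>auto simp: S_def hom_add hom_mult fun_eq_iff plus_fun_def\<close>)
  have cE: "card E = card (UNIV :: 'a set) ^ n"
    unfolding E_def by (subst card_supported) auto
  have kn: "k = n" using k(1) cE card_UNIV_gt_1 by (simp add: power_inject_exp)
  have "bij_betw (\<lambda>f. f 0) {f \<in> E. S f = f} (UNIV :: 'a set)"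
  proof (rule bij_betw_byWitness[where f' = "\<lambda>t i. if i < n then (\<sigma> ^^ i) t else 0"])
    show "\<forall>f\<in>{f \<in> E. S f = f}. (\<lambda>i. if i < n then (\<sigma> ^^ i) (f 0) else 0) = f"
    proof
      fix f assume f: "f \<in> {f \<in> E. S f = f}"
      have step: "f (Suc i) = \<sigma> (f i)" if "Suc i < n" for i
      proof -
        have "f (Suc i) = S f (Suc i)" using f by simp
        also have "\<dots> = \<sigma> (f ((i + n) mod n))" using that by (simp add: S_def)
        finally show ?thesis using that by simp
      qed
      have "(\<sigma> ^^ i) (f 0) = f i" if "i < n" for i
        using that by (induction i) (auto simp: step)
      then show "(\<lambda>i. if i < n then (\<sigma> ^^ i) (f 0) else 0) = f"
        using f by (auto simp: E_def)
    qed
    show "\<forall>t\<in>UNIV. (if 0 < n then (\<sigma> ^^ 0) t else 0) = t" using n_pos by simp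
    show "(\<lambda>t i. if i < n then (\<sigma> ^^ i) t else 0) ` UNIV \<subseteq> {f \<in> E. S f = f}"
    proof clarify
      fix t
      let ?f = "\<lambda>i. if i < n then (\<sigma> ^^ i) t else 0"
      have "S ?f i = ?f i" for i
      proof (cases "i = 0")
        case True
        have "\<sigma> ((\<sigma> ^^ (n - 1)) t) = (\<sigma> ^^ n) t" using n_pos by (cases n) auto
        then show ?thesis using n_pos True by (simp add: S_def funpow_n)
      next
        case False
        then obtain j where j: "i = Suc j" by (cases i) auto
        have "(i + (n - 1)) mod n = j" if "i < n"
        proof -
          have "i + (n - 1) = j + n" using j n_pos by simp
          then show ?thesis using that j by simp
        qed
        then show ?thesis using j n_pos by (auto simp: S_def)
      qed
      then show "?f \<in> E \<and> S ?f = ?f" by (auto simp: E_def)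
    qed
  qed simp
  from bij_betw_same_card[OF this] show ?thesis using k(2) kn by simp
qed

text \<open>Partial products for every length are needed because they are the factors that
  accumulate when a twisted map is iterated; the field norm is the case of length
  \<open>n\<close>.\<close>

definition norm_to :: "nat \<Rightarrow> 'a \<Rightarrow> 'a" where
  "norm_to k y = (\<Prod>i<k. (\<sigma> ^^ i) y)"

abbreviation nm :: "'a \<Rightarrow> 'a" where "nm \<equiv> norm_to n"

lemma norm_to_0 [simp]: "norm_to 0 y = 1"
  by (simp add: norm_to_def)

lemma norm_to_Suc: "norm_to (Suc k) y = y * \<sigma> (norm_to k y)"
  unfolding norm_to_def by (subst prod.lessThan_Suc_shift) (simp add: hom_prod)

lemma norm_to_Suc': "norm_to (Suc k) y = norm_to k y * (\<sigma> ^^ k) y"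
  unfolding norm_to_def by simp

lemma nm_mult: "nm (x * y) = nm x * nm y"
  by (simp add: norm_to_def funpow_mult prod.distrib)

lemma nm_eq_0_iff: "nm x = 0 \<longleftrightarrow> x = 0"
  using n_pos by (auto simp: norm_to_def funpow_eq_0_iff)

lemma nm_divide: "nm (x / y) = nm x / nm y"
proof (cases "y = 0")
  case False
  have "nm (x / y) * nm y = nm x" using False by (simp flip: nm_mult)
  then show ?thesis using False by (simp add: field_simps nm_eq_0_iff)
next
  case True
  then have "nm y = 0" by (simp only: nm_eq_0_iff)
  then show ?thesis using True by simp
qed

text \<open>Splitting the first or the last factor off \<open>norm_to (Suc n) y\<close>, where the
  last one is y again, gives y \<sigma>(N(y)) = N(y) y.\<close>

lemma hom_nm: "\<sigma> (nm y) = nm y"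
proof (cases "y = 0")
  case False
  have "y * \<sigma> (nm y) = y * nm y"
    using norm_to_Suc[of n y] unfolding norm_to_Suc' funpow_n id_apply by (simp only: mult.commute)
  then show ?thesis by (rule mult_left_cancel[THEN iffD1, OF False])
next
  case True
  then have "nm y = 0" by (simp only: nm_eq_0_iff)
  then show ?thesis by (simp only: hom_zero)
qed

lemma nm_hom: "nm (\<sigma> y) = nm y"
  using hom_nm[of y] by (simp add: norm_to_def hom_prod flip: funpow_swap1)

text \<open>A quantitative Hilbert 90: since y has norm 1, the map t to y \<sigma>(t) has trivial
  n-th iterate on a one-dimensional space, and descent applies. Any nonzero fixed t writes y as t /
  \<sigma>(t).\<close>

lemma card_twisted_fixed:
  assumes "nm y = 1"
  shows "card {t. y * \<sigma> t = t} = card fixed"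
proof -
  have pow: "((\<lambda>t. y * \<sigma> t) ^^ k) t = norm_to k y * (\<sigma> ^^ k) t" for k t
    by (induction k) (auto simp: norm_to_Suc hom_mult)
  interpret K: vector_space "(*) :: 'a \<Rightarrow> 'a \<Rightarrow> 'a" by (rule vector_space_self)
  obtain k where k: "card (UNIV :: 'a set) = card (UNIV :: 'a set) ^ k"
    "card {t \<in> UNIV. y * \<sigma> t = t} = card fixed ^ k"
  proof (rule descent[OF vector_space_self, of UNIV "\<lambda>t. y * \<sigma> t"])
    show "((\<lambda>t. y * \<sigma> t) ^^ n) t = t" for t
      by (simp only: pow assms funpow_n) simp
    show "y * \<sigma> (s + t) = y * \<sigma> s + y * \<sigma> t" for s t
      by (simp add: hom_add distrib_left)
    show "y * \<sigma> (s * t) = \<sigma> s * (y * \<sigma> t)" for s t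
      by (simp add: hom_mult)
  qed (use that in auto)
  have "k = 1"
    using k(1) card_UNIV_gt_1 power_inject_exp[of "card (UNIV :: 'a set)" 1 k] by simp
  then show ?thesis using k(2) by simp
qed

text \<open>Count the pairs (y, t) with t nonzero and y \<sigma>(t) = t twice: each y of norm 1
  admits \<open>card fixed - 1\<close> values of t, and each t determines y as t /
  \<sigma>(t).\<close>

lemma card_nm_one: "card {y. nm y = 1} * (card fixed - 1) = card (UNIV :: 'a set) - 1"
proof -
  let ?X = "SIGMA y:{y. nm y = 1}. {t. y * \<sigma> t = t} - {0}"
  have "card ?X = (\<Sum>y\<in>{y. nm y = 1}. card ({t. y * \<sigma> t = t} - {0}))"
    by (intro card_SigmaI) auto
  also have "\<dots> = (\<Sum>y\<in>{y. nm y = 1}. card fixed - 1)"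
    by (intro sum.cong refl, subst card_Diff_singleton) (auto simp: card_twisted_fixed hom_zero)
  also have "\<dots> = card {y. nm y = 1} * (card fixed - 1)" by simp
  finally have "card ?X = card {y. nm y = 1} * (card fixed - 1)" .
  moreover have "bij_betw snd ?X (UNIV - {0})"
    by (rule bij_betw_byWitness[where f' = "\<lambda>t. (t / \<sigma> t, t)"])
      (auto simp: nm_divide nm_hom nm_eq_0_iff hom_eq_0_iff field_simps)
  from bij_betw_same_card[OF this] have "card ?X = card (UNIV :: 'a set) - 1"
    by (simp add: card_Diff_singleton)
  ultimately show ?thesis by simp
qed

text \<open>Division by one element of a fibre embeds it into the fibre over 1, so no fibre is
  larger than that one. The fibres together exhaust the nonzero elements, which forces equality
  everywhere and makes every fibre nonempty.\<close>

lemma card_nm: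
  assumes "e \<in> fixed" "e \<noteq> 0"
  shows "card {y. nm y = e} * (card fixed - 1) = card (UNIV :: 'a set) - 1"
proof -
  let ?Z = "\<lambda>l. card {y. nm y = l}"
  have le: "?Z l \<le> ?Z 1" if "l \<in> fixed - {0}" for l
  proof (cases "{y. nm y = l} = {}")
    case False
    then obtain y0 where y0: "nm y0 = l" by blast
    with that have "y0 \<noteq> 0" using nm_eq_0_iff by auto
    then show ?thesis
      by (intro card_inj_on_le[of "\<lambda>y. y / y0"]) (use y0 that in \<open>auto simp: inj_on_def nm_divide\<close>)
  qed simp
  have "(\<Union>l\<in>fixed - {0}. {y. nm y = l}) = UNIV - {0}"
    by (auto simp: nm_eq_0_iff fixed_def hom_nm)
  then have "(\<Sum>l\<in>fixed - {0}. ?Z l) = card (UNIV - {0 :: 'a})"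
    by (subst card_UN_disjoint[symmetric]) auto
  then have S: "(\<Sum>l\<in>fixed - {0}. ?Z l) = card (UNIV :: 'a set) - 1"
    by (simp add: card_Diff_singleton)
  have "0 \<in> fixed" by (simp add: fixed_def hom_zero)
  then have "(\<Sum>l\<in>fixed - {0}. ?Z 1) = card (UNIV :: 'a set) - 1"
    using card_nm_one by (simp add: card_Diff_singleton mult.commute)
  with S have eq: "(\<Sum>l\<in>fixed - {0}. ?Z l) = (\<Sum>l\<in>fixed - {0}. ?Z 1)" by simp
  have "?Z e = ?Z 1"
    by (rule sum_mono_inv[OF eq]) (use le assms in auto)
  then show ?thesis using card_nm_one by simp
qed

end

subsection \<open>Roots of a given norm\<close>

locale sigma_cubic = cyclic_automorphism \<sigma> n for \<sigma> :: "'a::{field,finite} \<Rightarrow> 'a" and n +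
  fixes a b c d :: 'a
  assumes a_nz: "a \<noteq> 0" and d_nz: "d \<noteq> 0"
begin

abbreviation C :: "'a mat" where "C \<equiv> C_L a b c d"
abbreviation T :: "nat \<Rightarrow> 'a mat" where "T \<equiv> twisted_power \<sigma> C"
abbreviation A :: "'a mat" where "A \<equiv> A_L \<sigma> n a b c d"

definition C_inv :: "'a mat" where
  "C_inv = mat_of_rows_list 3 [[- b / a, 1, 0], [- c / a, 0, 1], [- d / a, 0, 0]]"

lemma C_carrier: "C \<in> carrier_mat 3 3" and C_inv_carrier: "C_inv \<in> carrier_mat 3 3"
  by (simp_all add: C_L_def C_inv_def mat_of_rows_list_def numeral_3_eq_3)

lemma less_3_iff: "i < (3::nat) \<longleftrightarrow> i = 0 \<or> i = 1 \<or> i = 2"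
  by auto

lemma C_C_inv: "C * C_inv = 1\<^sub>m 3"
  by (rule eq_matI) (use a_nz d_nz in \<open>auto simp: C_L_def C_inv_def mat_of_rows_list_def
    scalar_prod_def numeral_3_eq_3 less_Suc_eq\<close>)

lemma C_inv_C: "C_inv * C = 1\<^sub>m 3"
  by (rule mat_mult_left_right_inverse[OF C_carrier C_inv_carrier C_C_inv])

lemma lmul_C: "lmul 3 w C = (\<lambda>j. if j = 0 then w 1 else if j = 1 then w 2
    else if j = 2 then - (a * w 0 + b * w 1 + c * w 2) / d else 0)"
  by (rule ext) (auto simp: lmul_def C_L_def mat_of_rows_list_def less_3_iff numeral_3_eq_3
    numeral_2_eq_2 algebra_simps diff_divide_distrib add_divide_distrib)

lemma lmul_C_C_inv: "(\<And>i. i \<ge> 3 \<Longrightarrow> w i = 0) \<Longrightarrow> lmul 3 (lmul 3 w C) C_inv = w"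
  by (simp add: lmul_one C_C_inv flip: lmul_mult[OF C_carrier C_inv_carrier])

lemma lmul_C_inv_C: "(\<And>i. i \<ge> 3 \<Longrightarrow> w i = 0) \<Longrightarrow> lmul 3 (lmul 3 w C_inv) C = w"
  by (simp add: lmul_one C_inv_C flip: lmul_mult[OF C_inv_carrier C_carrier])

section \<open>Twisted powers of the companion matrix\<close>

lemma comm_ring_hom_funpow: "comm_ring_hom (\<sigma> ^^ k)"
proof -
  have "(\<sigma> ^^ k) (x + y) = (\<sigma> ^^ k) x + (\<sigma> ^^ k) y" for x y
    by (induction k) (auto simp: hom_add)
  then show ?thesis
    by unfold_locales (auto simp: funpow_one funpow_mult funpow_eq_0_iff)
qed

lemma map_mat_funpow_Suc: "map_mat (\<sigma> ^^ Suc k) B = map_mat \<sigma> (map_mat (\<sigma> ^^ k) B)"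
  by (rule eq_matI) auto

lemma map_mat_mult:
  assumes "B \<in> carrier_mat m m" "B' \<in> carrier_mat m m"
  shows "map_mat \<sigma> (B * B') = map_mat \<sigma> B * map_mat \<sigma> B'"
proof -
  interpret comm_ring_hom "\<sigma> ^^ 1" by (rule comm_ring_hom_funpow)
  show ?thesis using mat_hom_mult[OF assms] by simp
qed

lemma hom_lmul:
  "\<sigma> (lmul 3 w B j) = lmul 3 (\<lambda>i. \<sigma> (w i)) (map_mat \<sigma> B) j" if "B \<in> carrier_mat 3 3"
  using that by (simp add: lmul_def hom_sum hom_mult hom_zero)

lemma funpow_lmul:
  "(\<sigma> ^^ k) (lmul 3 w B j) = lmul 3 (\<lambda>i. (\<sigma> ^^ k) (w i)) (map_mat (\<sigma> ^^ k) B) j"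
  if "B \<in> carrier_mat 3 3"
proof (induction k)
  case (Suc k)
  then show ?case using that by (simp add: hom_lmul map_mat_funpow_Suc del: funpow.simps(2)) (simp add: hom_lmul)
qed (use that in \<open>simp add: lmul_def\<close>)

lemma T_carrier: "T k \<in> carrier_mat 3 3"
  using C_carrier by (induction k) auto

lemma A_carrier: "A \<in> carrier_mat 3 3"
  by (simp add: A_L_def T_carrier)

text \<open>\<open>twisted_power\<close> appends factors on the right; splitting one off on the left
  instead is what yields \<open>A_C\<close>.\<close>

lemma T_Suc': "T (Suc k) = C * map_mat \<sigma> (T k)"
proof (induction k)
  case 0
  interpret comm_ring_hom "\<sigma> ^^ 1" by (rule comm_ring_hom_funpow)
  show ?case using C_carrier mat_hom_one[of 3] by (auto simp: map_mat_def)
next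
  case (Suc k)
  have "T (Suc (Suc k)) = C * map_mat \<sigma> (T k) * map_mat \<sigma> (map_mat (\<sigma> ^^ k) C)"
    using Suc by (simp only: twisted_power.simps map_mat_funpow_Suc)
  also have "\<dots> = C * (map_mat \<sigma> (T k) * map_mat \<sigma> (map_mat (\<sigma> ^^ k) C))"
    using C_carrier T_carrier by (intro assoc_mult_mat) auto
  also have "map_mat \<sigma> (T k) * map_mat \<sigma> (map_mat (\<sigma> ^^ k) C) = map_mat \<sigma> (T (Suc k))"
    using C_carrier T_carrier by (subst map_mat_mult[symmetric, of _ 3]) auto
  finally show ?case .
qed

text \<open>Both sides are the twisted power with \<open>n + 1\<close> factors: the appended factor
  is C itself because the n-th iterate of \<sigma> is the identity.\<close>

lemma A_C: "A * C = C * map_mat \<sigma> A"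
proof -
  have "map_mat (\<sigma> ^^ n) C = C" by (rule eq_matI) (auto simp: funpow_n)
  then show ?thesis using T_Suc'[of n] by (simp add: A_L_def)
qed

lemma det_A_nz: "det A \<noteq> 0"
proof -
  have "det C * det C_inv = 1" using det_mult[OF C_carrier C_inv_carrier] C_C_inv by simp
  then have C: "det C \<noteq> 0" by auto
  have "det (T k) \<noteq> 0" for k
  proof (induction k)
    case 0 then show ?case using C_carrier by simp
  next
    case (Suc k)
    interpret comm_ring_hom "\<sigma> ^^ k" by (rule comm_ring_hom_funpow)
    have "det (map_mat (\<sigma> ^^ k) C) = (\<sigma> ^^ k) (det C)" by (rule hom_det)
    then show ?case
      using Suc C det_mult[OF T_carrier, of "map_mat (\<sigma> ^^ k) C" k] C_carrier
      by (simp add: funpow_eq_0_iff)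
  qed
  then show ?thesis by (simp add: A_L_def)
qed

section \<open>The semilinear map attached to a multiplier, and its fixed vectors\<close>

definition twist :: "'a \<Rightarrow> (nat \<Rightarrow> 'a) \<Rightarrow> nat \<Rightarrow> 'a" where
  "twist y w = lmul 3 (\<lambda>i. y * \<sigma> (w i)) C_inv"

text \<open>The fixed vectors of \<open>twist y\<close>, with the inverse of C cleared so that
  membership becomes explicit equations in the coordinates.\<close>

definition twist_space :: "'a \<Rightarrow> (nat \<Rightarrow> 'a) set" where
  "twist_space y = {w. (\<forall>i\<ge>3. w i = 0) \<and> lmul 3 w C = (\<lambda>i. y * \<sigma> (w i))}"

definition eigenspace :: "'a \<Rightarrow> (nat \<Rightarrow> 'a) set" where
  "eigenspace e = {w. (\<forall>i\<ge>3. w i = 0) \<and> lmul 3 w A = (\<lambda>i. e * w i)}"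

lemma twist_supported: "i \<ge> 3 \<Longrightarrow> twist y w i = 0"
  by (simp add: twist_def lmul_def)

lemma twist_C: "(\<forall>i\<ge>3. w i = 0) \<Longrightarrow> lmul 3 (twist y w) C = (\<lambda>i. y * \<sigma> (w i))"
  unfolding twist_def by (rule lmul_C_inv_C) (simp add: hom_zero)

lemma twist_eq_iff: "(\<forall>i\<ge>3. w i = 0) \<Longrightarrow> twist y w = w \<longleftrightarrow> w \<in> twist_space y"
proof
  assume w: "\<forall>i\<ge>3. w i = 0"
  show "twist y w = w \<Longrightarrow> w \<in> twist_space y" using twist_C[OF w, of y] w by (simp add: twist_space_def)
  assume "w \<in> twist_space y"
  then have "lmul 3 w C = (\<lambda>i. y * \<sigma> (w i))" by (simp add: twist_space_def)
  then show "twist y w = w" using lmul_C_C_inv[of w] w by (simp add: twist_def)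
qed

text \<open>Each application of \<open>twist y\<close> contributes one inverse of a conjugate of C,
  and \<open>T k\<close> cancels them one after another; only the scalars and the powers of \<sigma>
  survive.\<close>

lemma funpow_twist_T:
  assumes "\<forall>i\<ge>3. w i = 0"
  shows "lmul 3 ((twist y ^^ k) w) (T k) = (\<lambda>i. norm_to k y * (\<sigma> ^^ k) (w i))"
  using assms
proof (induction k arbitrary: w)
  case 0
  then show ?case using C_carrier by (simp add: lmul_one)
next
  case (Suc k)
  \<comment> \<open>The innermost twist is split off, so the induction hypothesis is used for
    \<open>twist y w\<close> in place of \<open>w\<close>.\<close>
  have "lmul 3 ((twist y ^^ Suc k) w) (T (Suc k))
      = lmul 3 (lmul 3 ((twist y ^^ k) (twist y w)) (T k)) (map_mat (\<sigma> ^^ k) C)"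
    using T_carrier C_carrier by (simp add: lmul_mult[of _ 3] funpow_swap1)
  also have "lmul 3 ((twist y ^^ k) (twist y w)) (T k) = (\<lambda>i. norm_to k y * (\<sigma> ^^ k) (twist y w i))"
    by (rule Suc.IH) (simp add: twist_supported)
  also have "lmul 3 \<dots> (map_mat (\<sigma> ^^ k) C) = (\<lambda>i. norm_to k y * (\<sigma> ^^ k) (lmul 3 (twist y w) C i))"
    by (simp add: lmul_scale funpow_lmul[OF C_carrier])
  also have "\<dots> = (\<lambda>i. norm_to (Suc k) y * (\<sigma> ^^ Suc k) (w i))"
    by (simp add: twist_C[OF Suc.prems] funpow_mult norm_to_Suc' funpow_swap1 mult.assoc)
  finally show ?case .
qed

lemma funpow_twist_A:
  assumes "\<forall>i\<ge>3. w i = 0"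
  shows "lmul 3 ((twist y ^^ n) w) A = (\<lambda>i. nm y * w i)"
  using funpow_twist_T[OF assms, where y = y and k = n] by (simp add: A_L_def funpow_n)

lemma twist_space_subset_eigenspace: "twist_space y \<subseteq> eigenspace (nm y)"
proof
  fix w assume w: "w \<in> twist_space y"
  then have supp: "\<forall>i\<ge>3. w i = 0" by (simp add: twist_space_def)
  have "twist y w = w" using w twist_eq_iff[OF supp] by simp
  then have "(twist y ^^ n) w = w" by (induction n) auto
  then show "w \<in> eigenspace (nm y)"
    using funpow_twist_A[OF supp, of y] supp by (simp add: eigenspace_def)
qed

text \<open>Compare after multiplying by the invertible C: this removes the inverse inside
  \<open>twist\<close>, \<open>A_C\<close> moves A past C, and the factor e survives \<sigma>
  because it is fixed.\<close>

lemma twist_eigenspace: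
  assumes e: "e \<in> fixed" and w: "w \<in> eigenspace e"
  shows "twist y w \<in> eigenspace e"
proof -
  have supp: "\<forall>i\<ge>3. w i = 0" and ev: "lmul 3 w A = (\<lambda>i. e * w i)"
    using w by (auto simp: eigenspace_def)
  have "lmul 3 (lmul 3 (twist y w) A) C = lmul 3 (lmul 3 (twist y w) C) (map_mat \<sigma> A)"
    using A_C A_carrier C_carrier by (simp flip: lmul_mult)
  also have "\<dots> = (\<lambda>i. y * \<sigma> (lmul 3 w A i))"
    by (simp add: twist_C[OF supp] lmul_scale hom_lmul[OF A_carrier])
  also have "\<dots> = (\<lambda>i. e * lmul 3 (twist y w) C i)"
    using e by (simp add: ev twist_C[OF supp] hom_mult fixed_def mult_ac)
  also have "\<dots> = lmul 3 (\<lambda>i. e * twist y w i) C" by (simp add: lmul_scale)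
  finally have "lmul 3 (lmul 3 (lmul 3 (twist y w) A) C) C_inv = lmul 3 (lmul 3 (\<lambda>i. e * twist y w i) C) C_inv"
    by simp
  then have "lmul 3 (twist y w) A = (\<lambda>i. e * twist y w i)"
    by (subst (asm) (1 2) lmul_C_C_inv) (simp_all add: lmul_def twist_supported)
  then show ?thesis by (simp add: eigenspace_def twist_supported)
qed

lemma card_eigenspace: "card (eigenspace e) = card (UNIV :: 'a set) ^ kernel_dim (char_matrix A e)"
proof -
  have "eigenspace e = {w. (\<forall>i\<ge>3. w i = 0) \<and> lmul 3 w (char_matrix A e) = (\<lambda>_. 0)}"
    by (auto simp: eigenspace_def lmul_char_matrix[OF A_carrier] fun_eq_iff)
  then show ?thesis using card_left_kernel[of "char_matrix A e" 3] A_carrier by simp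
qed

text \<open>Descent on the left eigenspace returns some exponent; comparison with
  \<open>card_eigenspace\<close> identifies it as the geometric multiplicity.\<close>

lemma card_twist_space:
  assumes "nm y = e" "e \<noteq> 0"
  shows "card (twist_space y) = card fixed ^ kernel_dim (char_matrix A e)"
proof -
  have e: "e \<in> fixed" using assms(1) hom_nm[of y] by (simp add: fixed_def)
  let ?E = "eigenspace e"
  have supp: "\<forall>i\<ge>3. w i = 0" if "w \<in> ?E" for w using that by (simp add: eigenspace_def)
  have fin: "finite ?E"
    by (rule finite_subset[OF _ finite_supported[of "{..<3}"]]) (auto dest: supp)
  have inv: "(twist y ^^ k) w \<in> ?E" if "w \<in> ?E" for k w
    using that by (induction k) (auto intro: twist_eigenspace[OF e])
  obtain k where k: "card ?E = card (UNIV :: 'a set) ^ k"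
    "card {w \<in> ?E. twist y w = w} = card fixed ^ k"
  proof (rule descent[OF vector_space_fun, of ?E "twist y"])
    show "module.subspace (\<lambda>(c::'a) (f::nat \<Rightarrow> 'a) i. c * f i) ?E"
      by (rule subspace_funI) (auto simp: eigenspace_def lmul_add lmul_scale lmul_def algebra_simps)
    show "finite ?E" by (rule fin)
    show "twist y w \<in> ?E" if "w \<in> ?E" for w using inv[OF that, of 1] by simp
    show "twist y (v + w) = twist y v + twist y w" for v w
      by (simp add: twist_def plus_fun_def hom_add distrib_left lmul_add)
    show "twist y (\<lambda>i. t * w i) = (\<lambda>i. \<sigma> t * twist y w i)" for t w
      unfolding twist_def by (simp add: hom_mult mult.left_commute[of y] flip: lmul_scale)
    show "(twist y ^^ n) w = w" if "w \<in> ?E" for w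
    proof
      fix i
      \<comment> \<open>Multiplying the iterate by A gives e times the iterate, as it stays in the
        eigenspace, and also e times w, by telescoping; the nonzero e then cancels.\<close>
      have "e * (twist y ^^ n) w i = lmul 3 ((twist y ^^ n) w) A i"
        using inv[OF that, of n] by (simp add: eigenspace_def)
      also have "\<dots> = e * w i" using funpow_twist_A[OF supp[OF that], of y] assms(1) by simp
      finally show "(twist y ^^ n) w i = w i" using assms(2) by simp
    qed
  qed (use that in blast)
  have "k = kernel_dim (char_matrix A e)"
    using card_UNIV_gt_1 k(1) card_eigenspace[of e] by (simp add: power_inject_exp)
  moreover have "{w \<in> ?E. twist y w = w} = twist_space y"
    using twist_space_subset_eigenspace[of y] assms(1) twist_eq_iff[of _ y] supp by (auto simp: twist_space_def)
  ultimately show ?thesis using k(2) by simp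
qed

section \<open>Fixed vectors in coordinates and the roots they encode\<close>

lemma twist_space_iff: "w \<in> twist_space y \<longleftrightarrow> (\<forall>i\<ge>3. w i = 0) \<and> w 1 = y * \<sigma> (w 0) \<and> w 2 = y * \<sigma> (w 1)
    \<and> a * w 0 + b * w 1 + c * w 2 + d * (y * \<sigma> (w 2)) = 0"
proof -
  have "lmul 3 w C = (\<lambda>i. y * \<sigma> (w i)) \<longleftrightarrow> w 1 = y * \<sigma> (w 0) \<and> w 2 = y * \<sigma> (w 1)
      \<and> - (a * w 0 + b * w 1 + c * w 2) / d = y * \<sigma> (w 2)" if "\<forall>i\<ge>3. w i = 0"
  proof
    assume h: "lmul 3 w C = (\<lambda>i. y * \<sigma> (w i))"
    show "w 1 = y * \<sigma> (w 0) \<and> w 2 = y * \<sigma> (w 1)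
      \<and> - (a * w 0 + b * w 1 + c * w 2) / d = y * \<sigma> (w 2)"
      using fun_cong[OF h, of 0] fun_cong[OF h, of 1] fun_cong[OF h, of 2] by (simp add: lmul_C)
  next
    assume h: "w 1 = y * \<sigma> (w 0) \<and> w 2 = y * \<sigma> (w 1)
      \<and> - (a * w 0 + b * w 1 + c * w 2) / d = y * \<sigma> (w 2)"
    have "lmul 3 w C i = y * \<sigma> (w i)" for i
    proof (cases "i < 3")
      case True
      then consider "i = 0" | "i = 1" | "i = 2" by linarith
      then show ?thesis
      proof cases
        case 3
        then show ?thesis using h[THEN conjunct2, THEN conjunct2] by (simp add: lmul_C)
      qed (use h in \<open>simp_all add: lmul_C\<close>)
    qed (use that in \<open>simp add: lmul_def hom_zero\<close>)
    then show "lmul 3 w C = (\<lambda>i. y * \<sigma> (w i))" by blast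
  qed
  moreover have "- u / d = v \<longleftrightarrow> u + d * v = 0" for u v
    by (simp only: nonzero_divide_eq_eq[OF d_nz] neg_eq_iff_add_eq_0 mult.commute)
  ultimately show ?thesis
    unfolding twist_space_def mem_Collect_eq by (simp only: cong: conj_cong)
qed

definition root_vec :: "'a \<Rightarrow> 'a \<Rightarrow> nat \<Rightarrow> 'a" where
  "root_vec y t i = (if i = 0 then t else if i = 1 then t * y else if i = 2 then t * y * \<sigma> y else 0)"

text \<open>Every multiplier y of norm e has \<open>card fixed ^ g - 1\<close> nonzero fixed
  vectors, where g is the kernel dimension. On the other side, each root of norm e and each nonzero
  scalar give exactly one pair, whose multiplier is another element of the same norm fibre.\<close>

lemma card_roots_nm:
  assumes e: "e \<in> fixed" "e \<noteq> 0"
  shows "card {y. P_L \<sigma> a b c d y = 0 \<and> nm y = e} * (card fixed - 1)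
    = card fixed ^ kernel_dim (char_matrix A e) - 1"
proof -
  let ?g = "kernel_dim (char_matrix A e)"
  let ?R = "{y. P_L \<sigma> a b c d y = 0 \<and> nm y = e}"
  let ?Z = "{y. nm y = e}"
  let ?zero = "\<lambda>_::nat. 0::'a"
  let ?X = "SIGMA y:?Z. twist_space y - {?zero}"
  have fin_twist: "finite (twist_space y)" for y
    by (rule finite_subset[OF _ finite_supported[of "{..<3}"]]) (auto simp: twist_space_def)
  have zero_twist: "?zero \<in> twist_space y" for y by (simp add: twist_space_iff hom_zero)
  have "card ?X = (\<Sum>y\<in>?Z. card (twist_space y - {?zero}))"
    by (intro card_SigmaI) (auto simp: fin_twist)
  also have "\<dots> = (\<Sum>y\<in>?Z. card fixed ^ ?g - 1)"
    using zero_twist e by (intro sum.cong refl, subst card_Diff_singleton) (auto simp: card_twist_space)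
  also have "\<dots> = card ?Z * (card fixed ^ ?g - 1)" by simp
  finally have X1: "card ?X = card ?Z * (card fixed ^ ?g - 1)" .
  \<comment> \<open>The first coordinate determines the other two, so a nonzero fixed vector can be
    scaled to begin with 1; the ratio of its first two coordinates is then the root.\<close>
  have nz: "w 0 \<noteq> 0" if "w \<in> twist_space y" "w \<noteq> ?zero" for w y
  proof
    assume "w 0 = 0"
    then have "w 0 = 0" "w 1 = 0" "w 2 = 0" using that(1) by (simp_all add: twist_space_iff hom_zero)
    then have "w i = 0" for i
      using that(1) by (cases "i < 3") (auto simp: twist_space_iff less_3_iff)
    then show False using that(2) by blast
  qed
  \<comment> \<open>Scaling the vector \<open>(1, y, y \<sigma>(y))\<close> by \<open>t\<close> changes its multiplier from \<open>y\<close> to \<open>y t / \<sigma>(t)\<close>.\<close>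
  have "bij_betw (\<lambda>(y, t). (y * t / \<sigma> t, root_vec y t)) (?R \<times> (UNIV - {0})) ?X"
  proof (rule bij_betw_byWitness[where f' = "\<lambda>(y, w). (w 1 / w 0, w 0)"])
    show "\<forall>p\<in>?R \<times> (UNIV - {0}). (\<lambda>(y, w). (w 1 / w 0, w 0)) ((\<lambda>(y, t). (y * t / \<sigma> t, root_vec y t)) p) = p"
      by (auto simp: root_vec_def)
    show "\<forall>p\<in>?X. (\<lambda>(y, t). (y * t / \<sigma> t, root_vec y t)) ((\<lambda>(y, w). (w 1 / w 0, w 0)) p) = p"
    proof
      fix p assume "p \<in> ?X"
      then obtain y w where p: "p = (y, w)" and w: "w \<in> twist_space y" "w \<noteq> ?zero" by auto
      have w0: "w 0 \<noteq> 0" "\<sigma> (w 0) \<noteq> 0" using nz[OF w] by (auto simp: hom_eq_0_iff)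
      have w12: "w 1 = y * \<sigma> (w 0)" "w 2 = y * \<sigma> (w 1)" "\<forall>i\<ge>3. w i = 0" using w(1) by (auto simp: twist_space_iff)
      have "w 1 / w 0 * w 0 / \<sigma> (w 0) = y" using w0 w12(1) by simp
      moreover have "root_vec (w 1 / w 0) (w 0) i = w i" for i
      proof (cases "i < 3")
        case True
        have "w 1 * \<sigma> (w 1 / w 0) = w 1 / \<sigma> (w 0) * \<sigma> (w 1)" by (simp add: hom_divide)
        also have "w 1 / \<sigma> (w 0) = y" using w0 w12(1) by simp
        finally have "w 1 * \<sigma> (w 1 / w 0) = w 2" using w12(2) by simp
        with True w0 show ?thesis by (auto simp: root_vec_def less_3_iff)
      qed (use w12(3) in \<open>auto simp: root_vec_def\<close>)
      ultimately show "(\<lambda>(y, t). (y * t / \<sigma> t, root_vec y t)) ((\<lambda>(y, w). (w 1 / w 0, w 0)) p) = p"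
        by (auto simp: p)
    qed
    show "(\<lambda>(y, t). (y * t / \<sigma> t, root_vec y t)) ` (?R \<times> (UNIV - {0})) \<subseteq> ?X"
    proof (rule image_subsetI)
      fix p assume "p \<in> ?R \<times> (UNIV - {0 :: 'a})"
      then obtain y t where p: "p = (y, t)" and y: "P_L \<sigma> a b c d y = 0" "nm y = e" and t: "t \<noteq> 0"
        by auto
      have st: "\<sigma> t \<noteq> 0" "nm t \<noteq> 0" using t by (auto simp: hom_eq_0_iff nm_eq_0_iff)
      have "nm (y * t / \<sigma> t) = nm y" using st by (simp add: nm_divide nm_mult nm_hom)
      moreover have "root_vec y t \<in> twist_space (y * t / \<sigma> t)"
      proof -
        have "a * t + b * (t * y) + c * (t * y * \<sigma> y) + d * (y * t / \<sigma> t * \<sigma> (t * y * \<sigma> y))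
            = t * P_L \<sigma> a b c d y"
          using st by (simp add: P_L_def hom_mult field_simps)
        then show ?thesis using st y(1) by (simp add: twist_space_iff root_vec_def hom_mult)
      qed
      moreover have "root_vec y t \<noteq> ?zero" using t by (metis root_vec_def)
      ultimately show "(\<lambda>(y, t). (y * t / \<sigma> t, root_vec y t)) p \<in> ?X" using y(2) by (simp add: p)
    qed
    show "(\<lambda>(y, w). (w 1 / w 0, w 0)) ` ?X \<subseteq> ?R \<times> (UNIV - {0})"
    proof (rule image_subsetI)
      fix p assume "p \<in> ?X"
      then obtain y w where p: "p = (y, w)" and y: "nm y = e" and w: "w \<in> twist_space y" "w \<noteq> ?zero" by auto
      have w0: "w 0 \<noteq> 0" "\<sigma> (w 0) \<noteq> 0" "\<sigma> (\<sigma> (w 0)) \<noteq> 0" "nm (w 0) \<noteq> 0"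
        using nz[OF w] by (auto simp: hom_eq_0_iff nm_eq_0_iff)
      have w12: "w 1 = y * \<sigma> (w 0)" "w 2 = y * \<sigma> (w 1)"
        "a * w 0 + b * w 1 + c * w 2 + d * (y * \<sigma> (w 2)) = 0" using w(1) by (auto simp: twist_space_iff)
      have "nm (w 1 / w 0) = nm y" using w0 unfolding w12(1) by (simp add: nm_divide nm_mult nm_hom)
      moreover have "w 0 * P_L \<sigma> a b c d (w 1 / w 0) = 0"
      proof -
        have "w 0 * P_L \<sigma> a b c d (w 1 / w 0)
            = a * w 0 + b * w 1 + c * w 2 + d * (y * \<sigma> (w 2))"
          using w0 unfolding P_L_def w12(1,2) by (simp add: hom_divide hom_mult field_simps)
        then show ?thesis using w12(3) by simp
      qed
      ultimately show "(\<lambda>(y, w). (w 1 / w 0, w 0)) p \<in> ?R \<times> (UNIV - {0})"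
        using w0 y by (simp add: p)
    qed
  qed
  from bij_betw_same_card[OF this] have "card ?X = card ?R * (card (UNIV :: 'a set) - 1)"
    by (simp add: card_cartesian_product card_Diff_singleton)
  \<comment> \<open>This brings out the factor \<open>card ?Z\<close>, which also occurs in the
    other count and can be cancelled because the fibre is nonempty.\<close>
  also have "\<dots> = card ?R * (card ?Z * (card fixed - 1))" by (simp only: card_nm[OF e])
  finally have X2: "card ?X = card ?R * (card ?Z * (card fixed - 1))" .
  have "card ?Z * (card ?R * (card fixed - 1)) = card ?Z * (card fixed ^ ?g - 1)"
    using X1 unfolding X2 by (simp only: mult.left_commute)
  moreover have "card ?Z > 0"
  proof -
    have "card ?Z * (card fixed - 1) > 0" 
      using card_UNIV_gt_1 by (simp only: card_nm[OF e] zero_less_diff)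
    then show ?thesis by (simp only: nat_0_less_mult_iff)
  qed
  ultimately show ?thesis using nat_mult_eq_cancel1 by blast
qed

end

subsection \<open>Possible multiplicities\<close>

text \<open>The arithmetic of the theorem, detached from the matrices. The bound
  \<open>card R < q\<close> excludes three eigenvalues unless q > 3, so the count q + 1
  characterises the pair (3,2) even for q = 2.\<close>

lemma root_count_classification:
  fixes m g Ne :: "'e \<Rightarrow> nat" and q :: nat
  assumes fin: "finite R" and q: "q \<ge> 2"
    and mg: "\<And>e. e \<in> R \<Longrightarrow> 1 \<le> g e \<and> g e \<le> m e"
    and sum_m: "sum m R \<le> 3" "sum m R \<noteq> 2"
    and Ne: "\<And>e. e \<in> R \<Longrightarrow> Ne e * (q - 1) = q ^ g e - 1"
    and R_le: "card R < q"
    and M: "M = image_mset (\<lambda>e. (m e, g e)) (mset_set R)"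
    and N: "N = sum Ne R"
  shows "(N = q\<^sup>2 + q + 1 \<longleftrightarrow> M = {#(3,3)#}) \<and>
        (N = q + 1 \<longleftrightarrow> M = {#(3,2)#}) \<and>
        (N = 1 \<longleftrightarrow> M = {#(3,1)#} \<or> M = {#(1,1)#}) \<and>
        (N = q + 2 \<longleftrightarrow> M = {#(1,1), (2,2)#}) \<and>
        (N = 2 \<longleftrightarrow> M = {#(1,1), (2,1)#}) \<and>
        (M = {#(1,1), (1,1), (1,1)#} \<longrightarrow> N = 3) \<and>
        (N = 3 \<and> q \<noteq> 2 \<longrightarrow> M = {#(1,1), (1,1), (1,1)#}) \<and>
        (N = 0 \<longleftrightarrow> M = {#}) \<and>
        N \<in> {q\<^sup>2 + q + 1, q + 1, 1, q + 2, 2, 3, 0} \<and>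
        M \<in> {{#(3,3)#}, {#(3,2)#}, {#(3,1)#}, {#(1,1)#}, {#(1,1), (2,2)#},
             {#(1,1), (2,1)#}, {#(1,1), (1,1), (1,1)#}, {#}}"
proof -
  have q1: "q - 1 > 0" using q by simp
  \<comment> \<open>(q^g - 1) / (q - 1) is the number of points of a projective space of dimension g
    - 1; for g = 1, 2, 3 it is 1, q + 1 and q^2 + q + 1.\<close>
  have Ne1: "Ne e = 1" if "e \<in> R" "g e = 1" for e
    using Ne[OF that(1)] that(2) q1 by simp
  have Ne2: "Ne e = q + 1" if "e \<in> R" "g e = 2" for e
  proof -
    have "q ^ 2 - 1 = (q + 1) * (q - 1)"
      using q by (simp add: power2_eq_square algebra_simps)
    then show ?thesis using Ne[OF that(1)] that(2) q1 by (metis mult_right_cancel less_numeral_extra(3))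
  qed
  have Ne3: "Ne e = q\<^sup>2 + q + 1" if "e \<in> R" "g e = 3" for e
  proof -
    have "q ^ 3 - 1 = (q\<^sup>2 + q + 1) * (q - 1)"
      using q by (simp add: power2_eq_square power3_eq_cube algebra_simps)
    then show ?thesis using Ne[OF that(1)] that(2) q1 by (metis mult_right_cancel less_numeral_extra(3))
  qed
  have "card R = (\<Sum>e\<in>R. 1)" by simp
  also have "\<dots> \<le> sum m R" by (rule sum_mono) (use mg in force)
  finally have cR: "card R \<le> sum m R" .
  have cases: "(M = {#} \<and> N = 0) \<or> (M = {#(3,3)#} \<and> N = q\<^sup>2 + q + 1) \<or> (M = {#(3,2)#} \<and> N = q + 1)
    \<or> (M = {#(3,1)#} \<and> N = 1) \<or> (M = {#(1,1)#} \<and> N = 1) \<or> (M = {#(1,1), (2,2)#} \<and> N = q + 2)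
    \<or> (M = {#(1,1), (2,1)#} \<and> N = 2) \<or> (M = {#(1,1), (1,1), (1,1)#} \<and> N = 3 \<and> q > 3)"
  proof -
    consider "card R = 0" | "card R = 1" | "card R = 2" | "card R = 3"
      using cR sum_m by linarith
    then show ?thesis
    proof cases
      case 1
      then show ?thesis using fin M N by simp
    next
      case 2
      then obtain x where R: "R = {x}" by (auto simp: card_1_singleton_iff)
      have M': "M = {#(m x, g x)#}" and N': "N = Ne x" using M N R by simp_all
      have "m x = 1 \<or> m x = 3" "1 \<le> g x" "g x \<le> m x" using sum_m mg[of x] R by auto
      then consider "m x = 1" "g x = 1" | "m x = 3" "g x = 1" | "m x = 3" "g x = 2" | "m x = 3" "g x = 3"
        by linarith
      then show ?thesis using Ne1[of x] Ne2[of x] Ne3[of x] R M' N' by cases simp_all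
    next
      case 3
      then obtain x y where xy: "R = {x, y}" "x \<noteq> y" by (auto simp: card_2_iff)
      \<comment> \<open>The total 2 is excluded, so the multiplicities add up to 3; the names are
        chosen anew so that x is the simple eigenvalue.\<close>
      have "\<exists>x y. R = {x, y} \<and> x \<noteq> y \<and> m x = 1 \<and> m y = 2"
      proof -
        have "m x + m y = 3" "m x \<ge> 1" "m y \<ge> 1"
          using sum_m mg[of x] mg[of y] cR xy by auto
        then have "(m x = 1 \<and> m y = 2) \<or> (m y = 1 \<and> m x = 2)" by linarith
        then show ?thesis using xy by (metis insert_commute)
      qed
      then obtain x y where R: "R = {x, y}" "x \<noteq> y" and m: "m x = 1" "m y = 2" by blast
      have M': "M = {#(m x, g x), (m y, g y)#}" and N': "N = Ne x + Ne y" using M N R by simp_all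
      have "g x = 1" "g y = 1 \<or> g y = 2" using mg[of x] mg[of y] R m by auto
      then show ?thesis using Ne1[of x] Ne1[of y] Ne2[of y] R m M' N' by auto
    next
      case 4
      then obtain x y z where R: "R = {x, y, z}" "x \<noteq> y" "y \<noteq> z" "x \<noteq> z"
        by (auto simp: card_3_iff)
      have M': "M = {#(m x, g x), (m y, g y), (m z, g z)#}" and N': "N = Ne x + Ne y + Ne z"
        using M N R by simp_all
      have "m x + m y + m z \<le> 3" using sum_m R by simp
      then have "m x = 1" "m y = 1" "m z = 1" "g x = 1" "g y = 1" "g z = 1"
        using mg[of x] mg[of y] mg[of z] R by auto
      then show ?thesis using Ne1[of x] Ne1[of y] Ne1[of z] R M' N' R_le 4 by simp
    qed
  qed
  have sq: "q\<^sup>2 \<ge> 2 * q" using q by (simp add: power2_eq_square)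
  have nq: "q \<noteq> 0" "q \<noteq> 1" "q\<^sup>2 \<noteq> 1" "q\<^sup>2 \<noteq> 0" "q\<^sup>2 + q \<noteq> 1" "q\<^sup>2 + q \<noteq> 2" "q\<^sup>2 + q + 1 \<noteq> q + 2"
    "q\<^sup>2 + q + 1 \<noteq> 3" "q\<^sup>2 + q + 1 \<noteq> 2" using sq q by linarith+
  have one: "Suc 0 \<noteq> q\<^sup>2" using sq q by linarith
  from cases show ?thesis
    by (elim disjE conjE) (use nq q in \<open>simp_all add: add_eq_conv_diff one\<close>)
qed

text \<open>The exponents are orders in p itself. They agree with the orders in the successive
  cofactors because the factors already removed do not vanish at the new point.\<close>

lemma root_factorization:
  fixes p :: "'a::field poly"
  assumes "finite R" "p \<noteq> 0"
  shows "\<exists>s. p = (\<Prod>r\<in>R. [:- r, 1:] ^ Polynomial.order r p) * s \<and> (\<forall>r\<in>R. poly s r \<noteq> 0)"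
  using assms(1)
proof induction
  case (insert x R)
  let ?\<Pi> = "\<Prod>r\<in>R. [:- r, 1:] ^ Polynomial.order r p"
  from insert.IH obtain s where s: "p = ?\<Pi> * s" "\<forall>r\<in>R. poly s r \<noteq> 0" by blast
  have "s \<noteq> 0" using s(1) assms(2) by auto
  have "poly ?\<Pi> x \<noteq> 0" using insert.hyps by (auto simp: poly_prod)
  then have "Polynomial.order x ?\<Pi> = 0" by (simp add: order_root)
  moreover have "Polynomial.order x (?\<Pi> * s) = Polynomial.order x ?\<Pi> + Polynomial.order x s"
    by (rule order_mult) (use s(1) assms(2) in simp)
  ultimately have ord: "Polynomial.order x s = Polynomial.order x p" using s(1) by simp
  obtain t where t: "s = [:- x, 1:] ^ Polynomial.order x s * t" "\<not> [:- x, 1:] dvd t"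
    using order_decomp[OF \<open>s \<noteq> 0\<close>] by blast
  have "poly t r \<noteq> 0" if "r \<in> insert x R" for r
  proof (cases "r = x")
    case True
    then show ?thesis using t(2) by (simp add: poly_eq_0_iff_dvd)
  next
    case False
    then have "poly s r \<noteq> 0" using s(2) that by simp
    then show ?thesis using t(1) by (metis poly_mult mult_zero_right)
  qed
  moreover have "p = (\<Prod>r\<in>insert x R. [:- r, 1:] ^ Polynomial.order r p) * t"
    using s(1) t(1) insert.hyps ord by (simp add: mult_ac)
  ultimately show ?case by blast
qed simp

section \<open>Transfer from the algebraic closure to the ground field\<close>

interpretation to_ac: field_hom "to_ac :: 'a::field \<Rightarrow> 'a alg_closure"
  by unfold_locales auto

interpretation to_ac: inj_idom_divide_hom "to_ac :: 'a::field \<Rightarrow> 'a alg_closure"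
  by unfold_locales auto

interpretation to_ac_poly: map_poly_inj_idom_divide_hom "to_ac :: 'a::field \<Rightarrow> 'a alg_closure" ..

text \<open>The embedding into the closure is injective and preserves orders of roots and kernel
  dimensions, so nothing later has to leave the finite field.\<close>

lemma multiplicity_pairs_eq:
  fixes B :: "'a::field mat"
  assumes B: "B \<in> carrier_mat m m"
  shows "multiplicity_pairs F B = image_mset
    (\<lambda>e. (Polynomial.order e (char_poly B), kernel_dim (char_matrix B e)))
    (mset_set {e \<in> F. poly (char_poly B) e = 0})"
proof -
  have cp: "char_poly (map_mat to_ac B) = map_poly to_ac (char_poly B)"
    by (rule to_ac.char_poly_hom[OF B])
  have "eigenvalue (map_mat to_ac B) (to_ac e) \<longleftrightarrow> poly (char_poly B) e = 0" for e
  proof -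
    have "eigenvalue (map_mat to_ac B) (to_ac e) \<longleftrightarrow> poly (char_poly (map_mat to_ac B)) (to_ac e) = 0"
      by (rule eigenvalue_root_char_poly[of _ m]) (use B in simp)
    then show ?thesis by (simp add: cp)
  qed
  then have ev: "eigenvalues_in F B = to_ac ` {e \<in> F. poly (char_poly B) e = 0}"
    by (auto simp: eigenvalues_in_def)
  have am: "alg_mult B (to_ac e) = Polynomial.order e (char_poly B)" for e
    by (simp add: alg_mult_def cp to_ac_poly.order_hom)
  have gm: "geom_mult B (to_ac e) = kernel_dim (char_matrix B e)" for e
  proof -
    have "char_matrix (map_mat to_ac B) (to_ac e) = map_mat to_ac (char_matrix B e)"
      using B by (intro eq_matI) (auto simp: char_matrix_def)
    then show ?thesis
      unfolding geom_mult_def using to_ac.kernel_dim_hom[of "char_matrix B e" m m] B by simp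
  qed
  have "mset_set (to_ac ` {e \<in> F. poly (char_poly B) e = 0})
      = image_mset to_ac (mset_set {e \<in> F. poly (char_poly B) e = 0})"
    by (rule image_mset_mset_set[symmetric]) (auto intro: inj_onI)
  then show ?thesis
    by (simp add: multiplicity_pairs_def ev am gm image_mset.compositionality o_def)
qed

section \<open>Eigenvalues in the fixed field and their multiplicities\<close>

context sigma_cubic begin

lemma char_poly_fixed: "map_poly \<sigma> (char_poly A) = char_poly A"
proof -
  interpret comm_ring_hom "\<sigma> ^^ 1" by (rule comm_ring_hom_funpow)
  have A': "map_mat \<sigma> A \<in> carrier_mat 3 3" using A_carrier by simp
  have "C * map_mat \<sigma> A * C_inv = A * (C * C_inv)"
    using A_C A_carrier C_carrier C_inv_carrier by (simp flip: A_C)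
  then have "A = C * map_mat \<sigma> A * C_inv" using C_C_inv A_carrier by simp
  then have "similar_mat A (map_mat \<sigma> A)"
    unfolding similar_mat_def
    by (intro exI[of _ C] exI[of _ C_inv] similar_mat_witI[OF C_C_inv C_inv_C])
      (use A_carrier A' C_carrier C_inv_carrier in auto)
  from char_poly_similar[OF this] show ?thesis using char_poly_hom[OF A_carrier] by simp
qed

definition eigenvalues_F :: "'a set" where "eigenvalues_F = {e \<in> fixed. poly (char_poly A) e = 0}"

lemma char_poly_A: "degree (char_poly A) = 3" "char_poly A \<noteq> 0"
  using degree_monic_char_poly[OF A_carrier] by auto

text \<open>After all roots in the fixed field are removed, the cofactor still has coefficients
  there. If it were linear, its root would be a further root in the fixed field.\<close>

lemma sum_order:
  "(\<Sum>e\<in>eigenvalues_F. Polynomial.order e (char_poly A)) \<le> 3 \<and> (\<Sum>e\<in>eigenvalues_F. Polynomial.order e (char_poly A)) \<noteq> 2"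
proof -
  let ?p = "char_poly A"
  let ?\<Pi> = "\<Prod>r\<in>eigenvalues_F. [:- r, 1:] ^ Polynomial.order r ?p"
  obtain s where s: "?p = ?\<Pi> * s" "\<forall>r\<in>eigenvalues_F. poly s r \<noteq> 0"
    using root_factorization[of eigenvalues_F ?p] char_poly_A by auto
  have nz: "?\<Pi> \<noteq> 0" "s \<noteq> 0" using s(1) char_poly_A(2) by auto
  have deg: "degree ?\<Pi> = (\<Sum>e\<in>eigenvalues_F. Polynomial.order e ?p)"
    by (subst degree_prod_eq_sum_degree) (auto simp: degree_linear_power)
  have sum3: "(\<Sum>e\<in>eigenvalues_F. Polynomial.order e ?p) + degree s = 3"
    using degree_mult_eq[OF nz] s(1) char_poly_A(1) deg by simp
  have "degree s \<noteq> 1"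
  proof
    assume ds: "degree s = 1"
    interpret h: comm_ring_hom \<sigma> using comm_ring_hom_funpow[of 1] by simp
    interpret mp: map_poly_comm_ring_hom \<sigma> ..
    have lin: "map_poly \<sigma> [:- r, 1:] = [:- r, 1:]" if "r \<in> eigenvalues_F" for r
      using that by (simp add: eigenvalues_F_def fixed_def hom_uminus map_poly_pCons hom_one)
    have "map_poly \<sigma> ?\<Pi> = ?\<Pi>"
      unfolding mp.hom_prod mp.hom_power by (intro prod.cong refl arg_cong2[where f = power] lin)
    then have "?\<Pi> * map_poly \<sigma> s = ?\<Pi> * s"
      using char_poly_fixed s(1) mp.hom_mult[of ?\<Pi> s] by metis
    then have fs: "map_poly \<sigma> s = s" using nz(1) by simp
    have cf: "\<sigma> (coeff s i) = coeff s i" for i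
      using arg_cong[OF fs, of "\<lambda>s. coeff s i"] by (simp add: coeff_map_poly hom_zero)
    \<comment> \<open>The root of the linear cofactor; as a quotient of fixed coefficients it is
      fixed by \<sigma>.\<close>
    define x where "x = - coeff s 0 / coeff s 1"
    have s1: "coeff s 1 \<noteq> 0" using ds nz(2) by (metis leading_coeff_0_iff)
    have "x \<in> fixed" by (simp add: x_def fixed_def hom_divide hom_uminus cf)
    moreover have "poly s x = 0"
      using s1 ds by (simp add: poly_altdef x_def)
    moreover from this have "poly ?p x = 0" by (subst s(1)) simp
    ultimately have "x \<in> eigenvalues_F" by (simp add: eigenvalues_F_def)
    then show False using s(2) \<open>poly s x = 0\<close> by blast
  qed
  then show ?thesis using sum3 by linarith
qed

text \<open>The transpose supplies a left eigenvector, so the left eigenspace has more than one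
  element and the exponent in \<open>card_eigenspace\<close> cannot be 0.\<close>

lemma kernel_dim_pos:
  assumes "poly (char_poly A) e = 0"
  shows "kernel_dim (char_matrix A e) \<ge> 1"
proof -
  have "eigenvalue (transpose_mat A) e"
    using assms A_carrier by (subst eigenvalue_root_char_poly[of _ 3]) auto
  then obtain v where v: "v \<in> carrier_vec 3" "v \<noteq> 0\<^sub>v 3" "transpose_mat A *\<^sub>v v = e \<cdot>\<^sub>v v"
    using A_carrier by (auto simp: eigenvalue_def eigenvector_def)
  define w where "w i = (if i < 3 then v $ i else 0)" for i
  have "lmul 3 w A j = e * w j" for j
  proof (cases "j < 3")
    case True
    have "(transpose_mat A *\<^sub>v v) $ j = (\<Sum>i<3. A $$ (i, j) * v $ i)"
      using True A_carrier v(1) by (simp add: scalar_prod_def atLeast0LessThan)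
    then show ?thesis using True v(1,3) by (simp add: lmul_def w_def mult.commute)
  qed (simp add: lmul_def w_def)
  then have "w \<in> eigenspace e" by (simp add: eigenspace_def w_def fun_eq_iff)
  moreover have "(\<lambda>_. 0) \<in> eigenspace e" by (simp add: eigenspace_def lmul_def fun_eq_iff)
  moreover have "w \<noteq> (\<lambda>_. 0)"
  proof
    assume "w = (\<lambda>_. 0)"
    then have "v $ i = 0" if "i < 3" for i using that by (simp add: w_def fun_eq_iff) (metis that)
    then have "v = 0\<^sub>v 3" using v(1) by (intro eq_vecI) auto
    then show False using v(2) by blast
  qed
  moreover have "kernel_dim (char_matrix A e) \<noteq> 0"
  proof
    assume "kernel_dim (char_matrix A e) = 0"
    then have "card (eigenspace e) = 1" by (simp add: card_eigenspace)
    then show False using calculation by (metis card_1_singletonE singletonD)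
  qed
  ultimately show ?thesis by simp
qed

text \<open>Serves two purposes: \<open>card_roots_nm\<close> needs a nonzero norm, and 0 is the
  element of the fixed field that keeps the number of eigenvalues below q.\<close>

lemma eigenvalues_F_nonzero: "e \<in> eigenvalues_F \<Longrightarrow> e \<noteq> 0"
proof
  assume "e \<in> eigenvalues_F" "e = 0"
  then have "det (- char_matrix A 0) = 0" using char_poly_matrix[OF A_carrier] by (simp add: eigenvalues_F_def)
  moreover have "char_matrix A 0 = A" using A_carrier by (intro eq_matI) (auto simp: char_matrix_def)
  moreover have "det (- A) \<noteq> 0"
  proof -
    have "- A = (- 1) \<cdot>\<^sub>m A" by (rule eq_matI) auto
    then show ?thesis using det_A_nz A_carrier by (simp add: det_smult)
  qed
  ultimately show False by simp
qed

definition num_roots :: "'a \<Rightarrow> nat" where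
  "num_roots e = card {y. P_L \<sigma> a b c d y = 0 \<and> nm y = e}"

text \<open>Sort the roots by norm. A norm that is not an eigenvalue has algebraic, hence geometric,
  multiplicity 0, and then \<open>card_roots_nm\<close> leaves no root of that norm.\<close>

lemma card_roots: "card {y. P_L \<sigma> a b c d y = 0} = sum num_roots eigenvalues_F"
proof -
  have "nm y \<in> eigenvalues_F" if y: "P_L \<sigma> a b c d y = 0" for y
  proof (rule ccontr)
    assume nR: "nm y \<notin> eigenvalues_F"
    have "y \<noteq> 0" using y a_nz by (auto simp: P_L_def)
    then have nz: "nm y \<noteq> 0" by (simp add: nm_eq_0_iff)
    have f: "nm y \<in> fixed" by (simp add: fixed_def hom_nm)
    then have "poly (char_poly A) (nm y) \<noteq> 0" using nR by (simp add: eigenvalues_F_def)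
    then have "Polynomial.order (nm y) (char_poly A) = 0" by (simp add: order_root)
    then have "kernel_dim (char_matrix A (nm y)) = 0"
      using kernel_dim_le_order[OF A_carrier, of "nm y"] by simp
    then have "num_roots (nm y) * (card fixed - 1) = 0"
      using card_roots_nm[OF f nz] by (simp add: num_roots_def)
    then have "num_roots (nm y) = 0" using card_fixed_gt_1 by simp
    then have "{z. P_L \<sigma> a b c d z = 0 \<and> nm z = nm y} = {}" by (simp add: num_roots_def)
    then show False using y by blast
  qed
  then have "{y. P_L \<sigma> a b c d y = 0} = (\<Union>e\<in>eigenvalues_F. {y. P_L \<sigma> a b c d y = 0 \<and> nm y = e})" by auto
  then show ?thesis unfolding num_roots_def by (simp only:) (rule card_UN_disjoint, auto)
qed

lemma card_eigenvalues_F: "card eigenvalues_F < card fixed"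
proof -
  have "0 \<in> fixed" by (simp add: fixed_def hom_zero)
  then have "eigenvalues_F \<subset> fixed" using eigenvalues_F_nonzero by (auto simp: eigenvalues_F_def)
  then show ?thesis by (intro psubset_card_mono) auto
qed

lemma multiplicity_pairs_A: "multiplicity_pairs fixed A = image_mset
    (\<lambda>e. (Polynomial.order e (char_poly A), kernel_dim (char_matrix A e))) (mset_set eigenvalues_F)"
  unfolding eigenvalues_F_def by (rule multiplicity_pairs_eq[OF A_carrier])

end

theorem theorem11:
  fixes \<sigma> :: "'a::{field,finite} \<Rightarrow> 'a"
    and F :: "'a set"
    and q n :: nat
    and a b c d :: 'a
  assumes "primepow q" and "n \<ge> 1"
    and "card (UNIV :: 'a set) = q ^ n"
    and "is_subfield F" and "card F = q"
    and "generates_galois_group \<sigma> F"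
    and "a * d \<noteq> 0"
  shows
    "let N = card {y. P_L \<sigma> a b c d y = 0};
         M = multiplicity_pairs F (A_L \<sigma> n a b c d)
     in (N = q\<^sup>2 + q + 1 \<longleftrightarrow> M = {#(3,3)#}) \<and>
        (N = q + 1 \<longleftrightarrow> M = {#(3,2)#}) \<and>
        (N = 1 \<longleftrightarrow> M = {#(3,1)#} \<or> M = {#(1,1)#}) \<and>
        (N = q + 2 \<longleftrightarrow> M = {#(1,1), (2,2)#}) \<and>
        (N = 2 \<longleftrightarrow> M = {#(1,1), (2,1)#}) \<and>
        (M = {#(1,1), (1,1), (1,1)#} \<longrightarrow> N = 3) \<and>
        (N = 3 \<and> q \<noteq> 2 \<longrightarrow> M = {#(1,1), (1,1), (1,1)#}) \<and>
        (N = 0 \<longleftrightarrow> M = {#}) \<and>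
        N \<in> {q\<^sup>2 + q + 1, q + 1, 1, q + 2, 2, 3, 0} \<and>
        M \<in> {{#(3,3)#}, {#(3,2)#}, {#(3,1)#}, {#(1,1)#}, {#(1,1), (2,2)#},
             {#(1,1), (2,1)#}, {#(1,1), (1,1), (1,1)#}, {#}}"
proof -
  have F: "{x. \<sigma> x = x} = F"
    by (rule fixed_points_of_generator) (use assms in blast)+
  have \<sigma>: "\<sigma> \<in> carrier (galois_group F)"
    using assms(6) by (simp add: generates_galois_group_def)
  \<comment> \<open>The order of \<sigma> is called \<open>k\<close> until it is known to be the
    degree \<open>n\<close>.\<close>
  then obtain k where k: "k > 0" "\<sigma> ^^ k = id" "inj_on (\<lambda>i. \<sigma> ^^ i) {..<k}"
    using finite_order_bij carrier_galois_group by metis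
  interpret \<sigma>: cyclic_automorphism \<sigma> k
    by unfold_locales (use \<sigma> k in \<open>auto simp: carrier_galois_group\<close>)
  have fixed: "\<sigma>.fixed = F" using F by (simp add: \<sigma>.fixed_def)
  \<comment> \<open>Both powers are the size of the large field; since q > 1, the exponents
    agree.\<close>
  have "q ^ n = q ^ k" using \<sigma>.card_UNIV_eq assms(3,5) fixed by simp
  moreover have q1: "q > 1" using \<sigma>.card_fixed_gt_1 fixed assms(5) by simp
  ultimately have kn: "k = n" by (simp add: power_inject_exp)
  interpret sigma_cubic \<sigma> n a b c d
    using \<sigma>.cyclic_automorphism_axioms assms(7)
    by (simp add: sigma_cubic_def sigma_cubic_axioms_def kn)
  have q: "card fixed = q" using fixed assms(5) kn by simp
  show ?thesis
    unfolding Let_def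
  proof (rule root_count_classification[where R = eigenvalues_F and Ne = num_roots
        and m = "\<lambda>e. Polynomial.order e (char_poly A)" and g = "\<lambda>e. kernel_dim (char_matrix A e)"])
    show "2 \<le> q" using q1 by simp
    show "1 \<le> kernel_dim (char_matrix A e) \<and>
        kernel_dim (char_matrix A e) \<le> Polynomial.order e (char_poly A)" if "e \<in> eigenvalues_F" for e
      using that kernel_dim_pos kernel_dim_le_order[OF A_carrier] by (simp add: eigenvalues_F_def)
    show "num_roots e * (q - 1) = q ^ kernel_dim (char_matrix A e) - 1" if "e \<in> eigenvalues_F" for e
      using card_roots_nm[of e] that eigenvalues_F_nonzero[OF that] q by (simp add: eigenvalues_F_def num_roots_def)
    show "card eigenvalues_F < q" using card_eigenvalues_F q by simp
    show "multiplicity_pairs F A = image_mset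
        (\<lambda>e. (Polynomial.order e (char_poly A), kernel_dim (char_matrix A e))) (mset_set eigenvalues_F)"
      using multiplicity_pairs_A fixed kn by simp
    show "card {y. P_L \<sigma> a b c d y = 0} = sum num_roots eigenvalues_F" by (rule card_roots)
  qed (use sum_order in auto)
qed

end
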